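(* Let Schröder packed floorplans grow by the block-addition procedure described below, keeping only the children that are Schröder packed floorplans. Then the resulting generating tree is isomorphic to the generating tree $\mathcal{T}_{\mathrm{Sch}}$ of the succession rule (NewSch): the root is labelled $(1,1)$, and $$(h,k)\rightsquigarrow(1,k+1),\ldots,(h,k+1),(2,1),\ldots,(2,k-1),(h+1,k).$$
   Context: A packed floorplan (PFP) of dimension $(d,\ell)$ is a partition of a $\ell$ (width) by $d$ (height) rectangle into $d+\ell-1$ rectangular blocks with integer side lengths, satisfying the following condition. For every pair of blocks $(b_1,b_2)$, with $(x_1,y_1)$ the bottom-right corner of $b_1$ and $(x_2,y_2)$ the top-left corner of $b_2$, one never has both $x_1\le x_2$ and $y_1\ge y_2$. Its size is $d+\ell-1$. Segments are maximal straight line segments formed by block sides. Internal segments are those not on the bounding rectangle. A Schröder PFP is a PFP whose internal segments contain no configuration of the following kind. There are a horizontal segment $w$, a vertical segment $a$, a vertical segment $s$ and a horizontal segment $t$ such that: - the upper endpoint of $a$ lies in the relative interior of $w$ (so $a$ hangs below $w$); - the right endpoint of $w$ lies in the relative interior of $s$, with $a$ to the left of $s$; - the lower endpoint of $s$ lies in the relative interior of $t$. Block-addition procedure. Let $F$ be a PFP of dimension $(d,\ell)$. Its children are of two kinds. - Children of dimension $(d,\ell+1)$: a new block $b$ is added to the right of the north-east corner of $F$. The left side of $b$ forms a new vertical segment that either reaches the bottom border or stops on any one of the internal segments of $F$ meeting the right border of $F$. The segments meeting the right border below that stopping point, together with their blocks, are extended to the new right border. - Children of dimension $(d+1,\ell)$: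 symmetrically, a new block $b$ is added on top of the north-east corner of $F$. Its bottom side either reaches the left border or stops on any one of the internal segments of $F$ meeting the upper border. The segments meeting the upper border to the left of that point are extended to the new top border. The root is the $1\times1$ floorplan. *)

theory Defs
  imports Main "HOL-Library.Disjoint_Sets"
begin

text \<open>
  Floorplans live on the integer grid, with the y-axis pointing upwards and the bounding rectangle
  having its bottom-left corner at the origin. Since all side lengths are integers, all corners
  are grid points, and a partition of the rectangle into blocks is the same as a partition of its
  unit cells; the cell \<open>(i, j)\<close> is the square with corners \<open>(i, j)\<close> and \<open>(i + 1, j + 1)\<close>.
\<close>

record block =
  x_left :: nat
  x_right :: nat
  y_bot :: nat
  y_top :: nat

record floorplan =
  width :: nat
  height :: nat
  blocks :: "block set"

definition cells :: "block \<Rightarrow> (nat \<times> nat) set" where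
  "cells b = {x_left b..<x_right b} \<times> {y_bot b..<y_top b}"

text \<open>Parts of a partition are nonempty, so \<^const>\<open>partition_on\<close> makes all blocks
  nondegenerate. The last condition excludes a block weakly to the right of and below another.\<close>

definition packed_floorplan :: "floorplan \<Rightarrow> bool" where
  "packed_floorplan F \<longleftrightarrow>
     width F \<ge> 1 \<and> height F \<ge> 1 \<and>
     partition_on ({0..<width F} \<times> {0..<height F}) (cells ` blocks F) \<and>
     card (blocks F) = height F + width F - 1 \<and>
     (\<forall>b1 \<in> blocks F. \<forall>b2 \<in> blocks F. \<not> (x_right b1 \<le> x_left b2 \<and> y_bot b1 \<ge> y_top b2))"


subsection \<open>Segments\<close>

text \<open>The unit edge from \<open>(i, y)\<close> to \<open>(i + 1, y)\<close>, respectively from \<open>(x, j)\<close> to \<open>(x, j + 1)\<close>,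
  lies on a side of a block.\<close>

definition h_edge :: "floorplan \<Rightarrow> nat \<Rightarrow> nat \<Rightarrow> bool" where
  "h_edge F y i \<longleftrightarrow>
     (\<exists>b \<in> blocks F. (y_bot b = y \<or> y_top b = y) \<and> x_left b \<le> i \<and> i < x_right b)"

definition v_edge :: "floorplan \<Rightarrow> nat \<Rightarrow> nat \<Rightarrow> bool" where
  "v_edge F x j \<longleftrightarrow>
     (\<exists>b \<in> blocks F. (x_left b = x \<or> x_right b = x) \<and> y_bot b \<le> j \<and> j < y_top b)"

text \<open>\<open>maximal_run P a c\<close>: the interval from \<open>a\<close> to \<open>c\<close> is a maximal one all of whose unit
  subintervals satisfy \<open>P\<close>.\<close>

definition maximal_run :: "(nat \<Rightarrow> bool) \<Rightarrow> nat \<Rightarrow> nat \<Rightarrow> bool" where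
  "maximal_run P a c \<longleftrightarrow>
     a < c \<and> (\<forall>i \<in> {a..<c}. P i) \<and>
     (\<forall>a' c'. a' \<le> a \<and> c \<le> c' \<and> (\<forall>i \<in> {a'..<c'}. P i) \<longrightarrow> a' = a \<and> c' = c)"

text \<open>\<open>internal_hseg F y a c\<close>: internal segment from \<open>(a, y)\<close> to \<open>(c, y)\<close>;
  \<open>internal_vseg F x a c\<close>: internal segment from \<open>(x, a)\<close> up to \<open>(x, c)\<close>.\<close>

definition internal_hseg :: "floorplan \<Rightarrow> nat \<Rightarrow> nat \<Rightarrow> nat \<Rightarrow> bool" where
  "internal_hseg F y a c \<longleftrightarrow> 0 < y \<and> y < height F \<and> maximal_run (h_edge F y) a c"

definition internal_vseg :: "floorplan \<Rightarrow> nat \<Rightarrow> nat \<Rightarrow> nat \<Rightarrow> bool" where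
  "internal_vseg F x a c \<longleftrightarrow> 0 < x \<and> x < width F \<and> maximal_run (v_edge F x) a c"


subsection \<open>Schroeder packed floorplans\<close>

text \<open>The segment \<open>w\<close> goes from \<open>(w1, yw)\<close> to \<open>(w2, yw)\<close>, \<open>a\<close> from \<open>(xa, a1)\<close> to \<open>(xa, a2)\<close>,
  \<open>s\<close> from \<open>(xs, s1)\<close> to \<open>(xs, s2)\<close>, and \<open>t\<close> from \<open>(t1, yt)\<close> to \<open>(t2, yt)\<close>.\<close>

definition forbidden_configuration :: "floorplan \<Rightarrow> bool" where
  "forbidden_configuration F \<longleftrightarrow>
     (\<exists>yw w1 w2 xa a1 a2 xs s1 s2 yt t1 t2.
        internal_hseg F yw w1 w2 \<and> internal_vseg F xa a1 a2 \<and>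
        internal_vseg F xs s1 s2 \<and> internal_hseg F yt t1 t2 \<and>
        (a2 = yw \<and> w1 < xa \<and> xa < w2) \<and>
        (w2 = xs \<and> s1 < yw \<and> yw < s2 \<and> xa < xs) \<and>
        (s1 = yt \<and> t1 < xs \<and> xs < t2))"

definition schroeder_pfp :: "floorplan \<Rightarrow> bool" where
  "schroeder_pfp F \<longleftrightarrow> packed_floorplan F \<and> \<not> forbidden_configuration F"


subsection \<open>Block addition\<close>

text \<open>\<open>add_right F y\<close> adds a block of width 1 whose left side goes from the north-east corner down
  to height \<open>y\<close>, and widens the blocks along the right border lying below \<open>y\<close>.\<close>

definition add_right :: "floorplan \<Rightarrow> nat \<Rightarrow> floorplan" where
  "add_right F y =
     \<lparr> width = width F + 1,
       height = height F,
       blocks =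
         insert \<lparr> x_left = width F, x_right = width F + 1, y_bot = y, y_top = height F \<rparr>
           ((\<lambda>b. if x_right b = width F \<and> y_top b \<le> y then b\<lparr>x_right := width F + 1\<rparr> else b)
              ` blocks F) \<rparr>"

definition add_top :: "floorplan \<Rightarrow> nat \<Rightarrow> floorplan" where
  "add_top F x =
     \<lparr> width = width F,
       height = height F + 1,
       blocks =
         insert \<lparr> x_left = x, x_right = width F, y_bot = height F, y_top = height F + 1 \<rparr>
           ((\<lambda>b. if y_top b = height F \<and> x_right b \<le> x then b\<lparr>y_top := height F + 1\<rparr> else b)
              ` blocks F) \<rparr>"

definition pfp_children :: "floorplan \<Rightarrow> floorplan set" where
  "pfp_children F =
     {add_right F y | y. y = 0 \<or> (\<exists>a. internal_hseg F y a (width F))} \<union>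
     {add_top F x | x. x = 0 \<or> (\<exists>a. internal_vseg F x a (height F))}"

definition unit_floorplan :: floorplan where
  "unit_floorplan =
     \<lparr> width = 1, height = 1,
       blocks = {\<lparr> x_left = 0, x_right = 1, y_bot = 0, y_top = 1 \<rparr>} \<rparr>"


subsection \<open>Generating trees\<close>

record 'v rooted_graph =
  nodes :: "'v set"
  root :: 'v
  child_rel :: "('v \<times> 'v) set"

definition rooted_iso :: "'v rooted_graph \<Rightarrow> 'w rooted_graph \<Rightarrow> bool" where
  "rooted_iso S T \<longleftrightarrow>
     root S \<in> nodes S \<and> root T \<in> nodes T \<and>
     (\<exists>f. bij_betw f (nodes S) (nodes T) \<and> f (root S) = root T \<and>
        (\<forall>u \<in> nodes S. \<forall>v \<in> nodes S.
           (u, v) \<in> child_rel S \<longleftrightarrow> (f u, f v) \<in> child_rel T))"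

text \<open>A node of the generating tree of a succession rule (with axiom \<open>ax\<close> and with \<open>rule l\<close> the
  list of labels of the children of a node labelled \<open>l\<close>) is given by its address, the list of
  child positions on the path leading to it from the root.\<close>

inductive succession_node :: "('l \<Rightarrow> 'l list) \<Rightarrow> 'l \<Rightarrow> nat list \<Rightarrow> 'l \<Rightarrow> bool"
  for rule :: "'l \<Rightarrow> 'l list" and ax :: 'l where
  axiom: "succession_node rule ax [] ax"
| child: "succession_node rule ax p l \<Longrightarrow> i < length (rule l) \<Longrightarrow>
    succession_node rule ax (p @ [i]) (rule l ! i)"

definition succession_tree :: "('l \<Rightarrow> 'l list) \<Rightarrow> 'l \<Rightarrow> nat list rooted_graph" where
  "succession_tree rule ax =
     (let N = {p. \<exists>l. succession_node rule ax p l} in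
      \<lparr> nodes = N, root = [], child_rel = {(p, q). p \<in> N \<and> q \<in> N \<and> (\<exists>i. q = p @ [i])} \<rparr>)"

fun new_sch :: "nat \<times> nat \<Rightarrow> (nat \<times> nat) list" where
  "new_sch (h, k) =
     map (\<lambda>i. (i, k + 1)) [1..<h + 1] @ map (\<lambda>j. (2, j)) [1..<k] @ [(h + 1, k)]"

definition T_Sch :: "nat list rooted_graph" where
  "T_Sch = succession_tree new_sch (1, 1)"

text \<open>In the generating tree of a class every object of the class occurs exactly once, so its
  nodes are the objects themselves. That all of them descend from the root, along a unique path,
  is part of being isomorphic to a succession tree.\<close>

definition schroeder_pfp_tree :: "floorplan rooted_graph" where
  "schroeder_pfp_tree =
     \<lparr> nodes = {F. schroeder_pfp F},
       root = unit_floorplan,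
       child_rel = {(F, G). schroeder_pfp F \<and> schroeder_pfp G \<and> G \<in> pfp_children F} \<rparr>"

end

theory Submission
  imports Defs
begin

text \<open>
  Call the segments meeting the right border of a Schroeder floorplan sites; the site \<open>0\<close>
  stands for the bottom border. A new left side that stops at a site crosses all the higher ones,
  and this creates the forbidden configuration unless none of those has a segment hanging below it
  or the side reaches the bottom border.
  A new bottom side that stops at a segment meeting the top border is always allowed, but every such
  segment further to the right then hangs below it. With \<open>h\<close> the number of allowed sites on the
  right and \<open>k\<close> the number of sites on top (borders included), this yields the succession rule.

  A parent exists because the block count forces exactly one segment on every inner grid line:
  each bottom-left corner other than the origin ends a vertical or a horizontal segment, and the
  packing condition allows one such corner per line. Hence the block in the north-east corner has
  width 1 if its left side ends at its lower corner, and height 1 if its bottom side ends there.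
\<close>

section \<open>Trees isomorphic to a succession tree\<close>

text \<open>Packed floorplans are closed under reflection in the diagonal, but the forbidden
  configuration is not invariant under it. Reflection therefore carries only the geometry of a right
  addition (partition, segments, sites) over to a top addition; forbidden configurations are
  analysed separately in the two directions. The outcome is asymmetric: a right addition can create
  one, a top addition never does. This is why the first entry of a label counts only active sites
  and the second all top sites. The constant 2 of the rule counts the bottom border and the segment
  just created: if something hangs below that segment, all lower internal sites become inactive. The
  running entries of the rule are ranks, because an addition separates from its border all sites
  beyond the stopping point. An isomorphism also requires that no floorplan has two parents and that
  parents of Schroeder floorplans are Schroeder. The former holds because the last addition can be
  read off the edges, the latter because an addition destroys no forbidden configuration.\<close>

lemma succession_tree_iso:
  fixes rule :: "'l \<Rightarrow> 'l list" and lab :: "'v \<Rightarrow> 'l" and ch :: "'v \<Rightarrow> 'v list"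
    and size_of :: "'v \<Rightarrow> nat"
  assumes r: "r \<in> N" "lab r = ax"
    and ch: "\<And>u. u \<in> N \<Longrightarrow> set (ch u) = {v \<in> N. (u, v) \<in> E}"
    and dist: "\<And>u. u \<in> N \<Longrightarrow> distinct (ch u)"
    and lab: "\<And>u. u \<in> N \<Longrightarrow> map lab (ch u) = rule (lab u)"
    and parent: "\<And>v. v \<in> N \<Longrightarrow> v \<noteq> r \<Longrightarrow> \<exists>u \<in> N. (u, v) \<in> E"
    and unique: "\<And>u u' v. (u, v) \<in> E \<Longrightarrow> (u', v) \<in> E \<Longrightarrow> u = u'"
    and size: "\<And>u v. (u, v) \<in> E \<Longrightarrow> size_of u < size_of v"
    and no_parent: "\<And>u. (u, r) \<notin> E"
  shows "rooted_iso \<lparr>nodes = N, root = r, child_rel = E\<rparr> (succession_tree rule ax)"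
proof -
  \<comment> \<open>Folding from the left makes appending a position to an address a step to a
    child, which matches the \<open>child\<close> rule of \<open>succession_node\<close>.\<close>
  define g where "g = foldl (\<lambda>u i. ch u ! i) r"
  define P where "P = {p. \<exists>l. succession_node rule ax p l}"
  have g_Nil: "g [] = r" and g_snoc: "\<And>p i. g (p @ [i]) = ch (g p) ! i"
    by (simp_all add: g_def)
  have len: "length (rule (lab u)) = length (ch u)" if "u \<in> N" for u
    using lab[OF that] by (metis length_map)
  have node: "g p \<in> N \<and> lab (g p) = l" if "succession_node rule ax p l" for p l
    using that
  proof induction
    case axiom
    then show ?case using r by (simp add: g_Nil)
  next
    case (child p l i)
    have u: "g p \<in> N" and l: "lab (g p) = l" using child.IH by simp_all
    have i: "i < length (ch (g p))" using len[OF u] l child.hyps(2) by simp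
    then have "ch (g p) ! i \<in> N" using ch[OF u] nth_mem[OF i] by simp
    moreover have "lab (ch (g p) ! i) = rule l ! i"
      using nth_map[OF i, of lab] lab[OF u] l by simp
    ultimately show ?case by (simp add: g_snoc)
  qed
  have gN: "g p \<in> N" if "p \<in> P" for p
    using that node by (auto simp: P_def)
  have snocD: "p \<in> P \<and> i < length (ch (g p))" if "p @ [i] \<in> P" for p i
  proof -
    from that obtain l where "succession_node rule ax (p @ [i]) l" by (auto simp: P_def)
    then obtain l' where l': "succession_node rule ax p l'" "i < length (rule l')"
      by cases simp_all
    then show ?thesis using node[OF l'(1)] len[of "g p"] by (auto simp: P_def)
  qed
  have snocI: "p @ [i] \<in> P" if "p \<in> P" "i < length (ch (g p))" for p i
  proof -
    from that obtain l where l: "succession_node rule ax p l" by (auto simp: P_def)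
    then show ?thesis
      using succession_node.child[OF l, of i] node[OF l] len[of "g p"] that(2) by (auto simp: P_def)
  qed
  have Nil_P: "[] \<in> P"
    using succession_node.axiom[of rule ax] by (auto simp: P_def)
  have edge: "(g p, g (p @ [i])) \<in> E" if "p @ [i] \<in> P" for p i
    using snocD[OF that] gN[of p] ch[of "g p"] nth_mem[of i "ch (g p)"] by (simp add: g_snoc)
  \<comment> \<open>Equal nodes have equal parents, so the addresses of the parents agree by
    induction, and distinctness of the child list fixes the last position. Against the empty
    address, \<open>no_parent\<close> decides.\<close>
  have inj: "p = q" if "p \<in> P" "q \<in> P" "g p = g q" for p q
    using that
  proof (induction p arbitrary: q rule: rev_induct)
    case Nil
    show ?case
    proof (rule ccontr)
      assume "[] \<noteq> q"
      then obtain q' j where "q = q' @ [j]" by (metis rev_exhaust)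
      then show False using edge[of q' j] no_parent[of "g q'"] Nil by (simp add: g_Nil)
    qed
  next
    case (snoc i p)
    show ?case
    proof (cases q rule: rev_cases)
      case Nil
      then show ?thesis
        using edge[of p i] no_parent[of "g p"] snoc.prems by (simp add: g_Nil)
    next
      case (snoc q' j)
      have gp: "g p = g q'"
        by (rule unique[OF edge[of p i]]) (use edge[of q' j] snoc.prems snoc in simp_all)
      have i: "p \<in> P" "i < length (ch (g p))" and j: "q' \<in> P" "j < length (ch (g q'))"
        using snocD[of p i] snocD[of q' j] snoc.prems snoc by simp_all
      have p: "p = q'" by (rule snoc.IH[OF i(1) j(1) gp])
      have "ch (g p) ! i = ch (g p) ! j"
        using snoc.prems(3) snoc p by (simp add: g_snoc)
      then have "i = j"
        using nth_eq_iff_index_eq[OF dist[OF gN[OF i(1)]] i(2), of j] j(2) gp by simp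
      then show ?thesis using p snoc by simp
    qed
  qed
  \<comment> \<open>The parent is smaller, so it already has an address, which is extended by the
    position of \<open>v\<close> among its children.\<close>
  have surj: "\<exists>p \<in> P. g p = v" if "v \<in> N" for v
    using that
  proof (induction v rule: measure_induct_rule[where f = size_of])
    case (less v)
    show ?case
    proof (cases "v = r")
      case True
      then show ?thesis using g_Nil Nil_P by auto
    next
      case False
      then obtain u where u: "u \<in> N" "(u, v) \<in> E" using parent[OF less.prems] by auto
      then obtain p where p: "p \<in> P" "g p = u" using less.IH[OF size[OF u(2)] u(1)] by auto
      have "v \<in> set (ch u)" using ch[OF u(1)] u(2) less.prems by simp
      then obtain i where "i < length (ch u)" "ch u ! i = v" by (metis in_set_conv_nth)
      then have "p @ [i] \<in> P" "g (p @ [i]) = v"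
        using snocI[OF p(1)] p(2) g_snoc by simp_all
      then show ?thesis by blast
    qed
  qed
  have bij: "bij_betw g P N"
    unfolding bij_betw_def inj_on_def using inj surj gN by fast
  define f where "f = inv_into P g"
  have f: "f v \<in> P" "g (f v) = v" if "v \<in> N" for v
    using bij_betwE[OF bij_betw_inv_into[OF bij]] bij_betw_inv_into_right[OF bij that] that
    unfolding f_def by simp_all
  have child: "(u, v) \<in> E \<longleftrightarrow> (\<exists>i. f v = f u @ [i])" if "u \<in> N" "v \<in> N" for u v
  proof
    assume "(u, v) \<in> E"
    then have "v \<in> set (ch u)" using ch[OF that(1)] that(2) by simp
    then obtain i where i: "i < length (ch u)" "ch u ! i = v" by (metis in_set_conv_nth)
    then have "f u @ [i] \<in> P" "g (f u @ [i]) = v"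
      using snocI[of "f u" i] f[OF that(1)] by (simp_all add: g_snoc)
    then show "\<exists>i. f v = f u @ [i]" using inj[of "f v" "f u @ [i]"] f[OF that(2)] by auto
  next
    assume "\<exists>i. f v = f u @ [i]"
    then obtain i where i: "f v = f u @ [i]" by blast
    then show "(u, v) \<in> E" using edge[of "f u" i] f[OF that(1)] f[OF that(2)] by simp
  qed
  have "f r = []"
    using inj[of "f r" "[]"] f[OF r(1)] g_Nil Nil_P by simp
  moreover have "bij_betw f N P" unfolding f_def by (rule bij_betw_inv_into[OF bij])
  moreover note Nil_P
  ultimately show ?thesis
    unfolding rooted_iso_def succession_tree_def Let_def P_def[symmetric]
    using r(1) child f(1) by (simp; intro exI[of _ f]; simp)
qed

section \<open>Blocks of a packed floorplan\<close>

lemma mem_cells [simp]: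
  "(i, j) \<in> cells b \<longleftrightarrow> x_left b \<le> i \<and> i < x_right b \<and> y_bot b \<le> j \<and> j < y_top b"
  by (auto simp: cells_def)

definition nondegenerate :: "block \<Rightarrow> bool" where
  "nondegenerate b \<longleftrightarrow> x_left b < x_right b \<and> y_bot b < y_top b"

lemma cells_eq_empty_iff: "cells b = {} \<longleftrightarrow> \<not> nondegenerate b"
  by (auto simp: cells_def nondegenerate_def)

text \<open>A product of nonempty intervals determines its factors. Nondegeneracy matters, since all
  degenerate blocks share the empty cell set.\<close>

lemma cells_inject:
  assumes "nondegenerate b" "nondegenerate c" "cells b = cells c"
  shows "b = c"
proof -
  have "{x_left b..<x_right b} = {x_left c..<x_right c}"
    "{y_bot b..<y_top b} = {y_bot c..<y_top c}"
    using assms unfolding cells_def nondegenerate_def by (auto simp: times_eq_iff)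
  then show ?thesis
    using assms(1,2) unfolding nondegenerate_def
    by (intro block.equality) (auto simp: atLeastLessThan_eq_iff)
qed

text \<open>Pointwise form of the partition condition, phrased with blocks in place of cell sets.
  The last clause combines disjointness with the fact that distinct blocks have distinct cell
  sets.\<close>

definition tiling :: "floorplan \<Rightarrow> bool" where
  "tiling F \<longleftrightarrow>
     (\<forall>b \<in> blocks F. nondegenerate b \<and> x_right b \<le> width F \<and> y_top b \<le> height F) \<and>
     (\<forall>i < width F. \<forall>j < height F. \<exists>b \<in> blocks F. (i, j) \<in> cells b) \<and>
     (\<forall>b \<in> blocks F. \<forall>c \<in> blocks F. \<forall>i j. (i, j) \<in> cells b \<longrightarrow> (i, j) \<in> cells c \<longrightarrow> b = c)"

lemma tiling_iff_partition_on:
  "tiling F \<longleftrightarrow> partition_on ({0..<width F} \<times> {0..<height F}) (cells ` blocks F)"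
  (is "_ \<longleftrightarrow> partition_on ?A _")
proof
  assume t: "tiling F"
  show "partition_on ?A (cells ` blocks F)"
  proof (rule partition_onI)
    show "\<Union> (cells ` blocks F) = ?A"
      using t unfolding tiling_def by (auto 0 4)
    show "{} \<notin> cells ` blocks F"
      using t unfolding tiling_def by (metis cells_eq_empty_iff imageE)
    show "disjnt p q" if "p \<in> cells ` blocks F" "q \<in> cells ` blocks F" "p \<noteq> q" for p q
    proof -
      from that obtain b c where b: "b \<in> blocks F" "p = cells b" and c: "c \<in> blocks F" "q = cells c"
        by blast
      show ?thesis
      proof (rule ccontr)
        assume "\<not> disjnt p q"
        then obtain i j where "(i, j) \<in> cells b" "(i, j) \<in> cells c"
          unfolding disjnt_def b c by (auto simp del: mem_cells)
        then have "b = c" using t b(1) c(1) unfolding tiling_def by blast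
        then show False using that(3) b c by simp
      qed
    qed
  qed
next
  assume p: "partition_on ?A (cells ` blocks F)"
  have nd: "nondegenerate b" if "b \<in> blocks F" for b
    using partition_onD3[OF p] that cells_eq_empty_iff by force
  have sub: "cells b \<subseteq> ?A" if "b \<in> blocks F" for b
    using partition_onD1[OF p] that by blast
  have "x_right b \<le> width F \<and> y_top b \<le> height F" if "b \<in> blocks F" for b
  proof -
    have "(x_right b - 1, y_top b - 1) \<in> cells b"
      using nd[OF that] by (auto simp: nondegenerate_def)
    then have "(x_right b - 1, y_top b - 1) \<in> ?A" using sub[OF that] by blast
    then show ?thesis by auto
  qed
  moreover have "\<exists>b \<in> blocks F. (i, j) \<in> cells b" if "i < width F" "j < height F" for i j
  proof -
    have "(i, j) \<in> ?A" using that by simp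
    then show ?thesis using partition_onD1[OF p] by (metis UN_E)
  qed
  moreover have "b = c"
    if "b \<in> blocks F" "c \<in> blocks F" "(i, j) \<in> cells b" "(i, j) \<in> cells c" for b c i j
  proof -
    have "cells b = cells c"
      using partition_onD2[OF p] that unfolding disjoint_def by blast
    then show ?thesis using cells_inject nd that by blast
  qed
  ultimately show "tiling F" unfolding tiling_def using nd by blast
qed

lemma packed_floorplan_iff:
  "packed_floorplan F \<longleftrightarrow>
     width F \<ge> 1 \<and> height F \<ge> 1 \<and> tiling F \<and>
     card (blocks F) = height F + width F - 1 \<and>
     (\<forall>b \<in> blocks F. \<forall>c \<in> blocks F. x_right b \<le> x_left c \<longrightarrow> y_top c \<le> y_bot b \<longrightarrow> False)"
  unfolding packed_floorplan_def tiling_iff_partition_on by blast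

lemma tiling_block:
  assumes "tiling F" "b \<in> blocks F"
  shows "x_left b < x_right b" "x_right b \<le> width F" "y_bot b < y_top b" "y_top b \<le> height F"
  using assms unfolding tiling_def nondegenerate_def by auto

lemma tiling_cover:
  assumes "tiling F" "i < width F" "j < height F"
  obtains b where "b \<in> blocks F" "x_left b \<le> i" "i < x_right b" "y_bot b \<le> j" "j < y_top b"
  using assms unfolding tiling_def mem_cells by blast

lemma tiling_eq:
  assumes "tiling F" "b \<in> blocks F" "c \<in> blocks F"
    and "x_left b \<le> i" "i < x_right b" "y_bot b \<le> j" "j < y_top b"
    and "x_left c \<le> i" "i < x_right c" "y_bot c \<le> j" "j < y_top c"
  shows "b = c"
  using assms unfolding tiling_def mem_cells by blast

lemma packed_tiling: "packed_floorplan F \<Longrightarrow> tiling F"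
  by (simp add: packed_floorplan_iff)

lemma packed_no_lower_right:
  assumes "packed_floorplan F" "b \<in> blocks F" "c \<in> blocks F" "x_right b \<le> x_left c"
  shows "y_bot b < y_top c"
  using assms unfolding packed_floorplan_iff by (meson not_le)

lemma packed_finite:
  assumes "packed_floorplan F"
  shows "finite (blocks F)"
  by (rule card_ge_0_finite) (use assms in \<open>auto simp: packed_floorplan_iff\<close>)

text \<open>The bottom-left corner of a block is \<open>v_rooted\<close> if the vertical line through it ends there
  and \<open>h_rooted\<close> if the horizontal one does. The packing condition allows one such
  corner per grid line, so the block count forces exactly one on each.\<close>

definition v_rooted :: "floorplan \<Rightarrow> block \<Rightarrow> bool" where
  "v_rooted F b \<longleftrightarrow> (\<exists>c \<in> blocks F. x_right c = x_left b \<and> y_bot c = y_bot b)"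

definition h_rooted :: "floorplan \<Rightarrow> block \<Rightarrow> bool" where
  "h_rooted F b \<longleftrightarrow> (\<exists>c \<in> blocks F. y_top c = y_bot b \<and> x_left c = x_left b)"

text \<open>The cell just left of \<open>b\<close> in row \<open>y\<close> lies in some block, and
  that block must end at the left side of \<open>b\<close>, since otherwise it would overlap
  \<open>b\<close>.\<close>

lemma tiling_left_neighbour:
  assumes F: "tiling F" and b: "b \<in> blocks F" and x: "0 < x_left b" and y: "y_bot b \<le> y" "y < y_top b"
  obtains c where "c \<in> blocks F" "x_right c = x_left b" "y_bot c \<le> y" "y < y_top c"
proof -
  note nb = tiling_block[OF F b]
  have "x_left b - 1 < width F" "y < height F" using nb y by auto
  then obtain c where c: "c \<in> blocks F" "x_left c \<le> x_left b - 1" "x_left b - 1 < x_right c"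
      "y_bot c \<le> y" "y < y_top c"
    by (rule tiling_cover[OF F])
  have "x_right c = x_left b"
  proof (rule ccontr)
    assume "x_right c \<noteq> x_left b"
    then have "b = c"
      using tiling_eq[OF F b c(1), of "x_left b" y] nb y c by simp
    then show False using c x by simp
  qed
  then show thesis using that c by blast
qed

lemma tiling_lower_neighbour:
  assumes F: "tiling F" and b: "b \<in> blocks F" and y: "0 < y_bot b" and x: "x_left b \<le> x" "x < x_right b"
  obtains c where "c \<in> blocks F" "y_top c = y_bot b" "x_left c \<le> x" "x < x_right c"
proof -
  note nb = tiling_block[OF F b]
  have "x < width F" "y_bot b - 1 < height F" using nb x by auto
  then obtain c where c: "c \<in> blocks F" "x_left c \<le> x" "x < x_right c"
      "y_bot c \<le> y_bot b - 1" "y_bot b - 1 < y_top c"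
    by (rule tiling_cover[OF F])
  have "y_top c = y_bot b"
  proof (rule ccontr)
    assume "y_top c \<noteq> y_bot b"
    then have "b = c"
      using tiling_eq[OF F b c(1), of x "y_bot b"] nb x c by simp
    then show False using c y by simp
  qed
  then show thesis using that c by blast
qed

text \<open>If neither line ended at the corner, the block to its left would extend below it and the
  block beneath it would extend to its left. Both would contain the cell diagonally below and left
  of the corner, hence coincide, although one rises above the corner and the other ends at its
  height.\<close>

lemma tiling_rooted:
  assumes F: "tiling F" and b: "b \<in> blocks F" and nz: "x_left b \<noteq> 0 \<or> y_bot b \<noteq> 0"
  shows "v_rooted F b \<or> h_rooted F b"
proof (rule ccontr)
  assume n: "\<not> (v_rooted F b \<or> h_rooted F b)"
  note nb = tiling_block[OF F b]
  show False
  proof (cases "x_left b = 0")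
    case True
    then obtain c where "c \<in> blocks F" "y_top c = y_bot b" "x_left c \<le> x_left b"
      using tiling_lower_neighbour[OF F b, of "x_left b"] nb nz by auto
    then show False using n True unfolding h_rooted_def by force
  next
    case False
    then obtain c where c: "c \<in> blocks F" "x_right c = x_left b" "y_bot c \<le> y_bot b" "y_bot b < y_top c"
      using tiling_left_neighbour[OF F b, of "y_bot b"] nb by auto
    then have cy: "y_bot c < y_bot b" using n unfolding v_rooted_def by force
    then obtain e where e: "e \<in> blocks F" "y_top e = y_bot b" "x_left e \<le> x_left b" "x_left b < x_right e"
      using tiling_lower_neighbour[OF F b, of "x_left b"] nb by auto
    then have ex: "x_left e < x_left b" using n unfolding h_rooted_def by force
    note nc = tiling_block[OF F c(1)] and ne = tiling_block[OF F e(1)]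
    have "c = e"
      by (rule tiling_eq[OF F c(1) e(1), of "x_left b - 1" "y_bot b - 1"])
        (use nc ne c e cy ex in auto)
    then show False using c e by simp
  qed
qed

text \<open>Suppose the upper of two left sides on one line is rooted. The block to its left with
  the same bottom has the lower block to its right, so packing makes the lower block rise past the
  bottom of the upper one, and the two overlap.\<close>

lemma packed_inj_v_rooted:
  assumes F: "packed_floorplan F"
  shows "inj_on x_left {b \<in> blocks F. v_rooted F b}"
proof (rule inj_onI)
  have *: "\<not> y_bot b' < y_bot b"
    if b: "b \<in> blocks F" "v_rooted F b" and b': "b' \<in> blocks F" and x: "x_left b = x_left b'" for b b'
  proof
    assume lt: "y_bot b' < y_bot b"
    note t = packed_tiling[OF F]
    from b(2) obtain c where c: "c \<in> blocks F" "x_right c = x_left b" "y_bot c = y_bot b"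
      unfolding v_rooted_def by blast
    have "y_bot b < y_top b'" using packed_no_lower_right[OF F c(1) b'] c x by simp
    then have "b = b'"
      using tiling_eq[OF t b(1) b', of "x_left b" "y_bot b"] lt x
        tiling_block[OF t b(1)] tiling_block[OF t b'] by simp
    then show False using lt by simp
  qed
  fix b b' assume b: "b \<in> {b \<in> blocks F. v_rooted F b}" "b' \<in> {b \<in> blocks F. v_rooted F b}"
    and x: "x_left b = x_left b'"
  have "y_bot b = y_bot b'"
    using *[of b b'] *[of b' b] b x by simp
  then show "b = b'"
    using tiling_eq[OF packed_tiling[OF F], of b b' "x_left b" "y_bot b"] b x
      tiling_block(1,3)[OF packed_tiling[OF F], of b] tiling_block(1,3)[OF packed_tiling[OF F], of b'] by simp
qed

text \<open>Of two blocks with bottom sides on one line, packing compares the left one with the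
  block beneath the corner of the right one, and again forces an overlap.\<close>

lemma packed_inj_h_rooted:
  assumes F: "packed_floorplan F"
  shows "inj_on y_bot {b \<in> blocks F. h_rooted F b}"
proof (rule inj_onI)
  have *: "\<not> x_left b' < x_left b"
    if b: "b \<in> blocks F" "h_rooted F b" and b': "b' \<in> blocks F" and y: "y_bot b = y_bot b'" for b b'
  proof
    assume lt: "x_left b' < x_left b"
    note t = packed_tiling[OF F]
    from b(2) obtain c where c: "c \<in> blocks F" "y_top c = y_bot b" "x_left c = x_left b"
      unfolding h_rooted_def by blast
    have "x_left b < x_right b'"
      using packed_no_lower_right[OF F b' c(1)] c y by (cases "x_left b < x_right b'") simp_all
    then have "b = b'"
      using tiling_eq[OF t b(1) b', of "x_left b" "y_bot b"] lt y
        tiling_block[OF t b(1)] tiling_block[OF t b'] by simp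
    then show False using lt by simp
  qed
  fix b b' assume b: "b \<in> {b \<in> blocks F. h_rooted F b}" "b' \<in> {b \<in> blocks F. h_rooted F b}"
    and y: "y_bot b = y_bot b'"
  have "x_left b = x_left b'"
    using *[of b b'] *[of b' b] b y by simp
  then show "b = b'"
    using tiling_eq[OF packed_tiling[OF F], of b b' "x_left b" "y_bot b"] b y
      tiling_block(1,3)[OF packed_tiling[OF F], of b] tiling_block(1,3)[OF packed_tiling[OF F], of b'] by simp
qed

text \<open>There are at most \<open>width F - 1\<close> blocks that are \<open>v_rooted\<close>, at
  most \<open>height F - 1\<close> that are \<open>h_rooted\<close>, and at most one at the origin.
  These bounds add up to exactly the number of blocks, so the first is attained and every inner
  vertical line is hit.\<close>

lemma packed_v_rooted_exists:
  assumes F: "packed_floorplan F" and x: "0 < x" "x < width F"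
  obtains b where "b \<in> blocks F" "v_rooted F b" "x_left b = x"
proof -
  note t = packed_tiling[OF F]
  let ?V = "{b \<in> blocks F. v_rooted F b}" and ?H = "{b \<in> blocks F. h_rooted F b}"
  let ?C = "{b \<in> blocks F. x_left b = 0 \<and> y_bot b = 0}"
  have fin: "finite ?V" "finite ?H" "finite ?C" using packed_finite[OF F] by auto
  have vx: "0 < x_left b" if "b \<in> ?V" for b
    proof -
    from that obtain c where "c \<in> blocks F" "x_right c = x_left b"
      unfolding v_rooted_def by blast
    then show ?thesis using tiling_block(1)[OF t, of c] by simp
  qed
  have hy: "0 < y_bot b" if "b \<in> ?H" for b
    proof -
    from that obtain c where "c \<in> blocks F" "y_top c = y_bot b"
      unfolding h_rooted_def by blast
    then show ?thesis using tiling_block(3)[OF t, of c] by simp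
  qed
  have V: "x_left ` ?V \<subseteq> {1..<width F}"
  proof
    fix i assume "i \<in> x_left ` ?V"
    then obtain b where b: "b \<in> ?V" "i = x_left b" by blast
    then show "i \<in> {1..<width F}"
      using vx[OF b(1)] tiling_block(1,2)[OF t, of b] by auto
  qed
  have H: "y_bot ` ?H \<subseteq> {1..<height F}"
  proof
    fix i assume "i \<in> y_bot ` ?H"
    then obtain b where b: "b \<in> ?H" "i = y_bot b" by blast
    then show "i \<in> {1..<height F}"
      using hy[OF b(1)] tiling_block(3,4)[OF t, of b] by auto
  qed
  have cV: "card ?V = card (x_left ` ?V)"
    by (rule card_image[symmetric]) (rule packed_inj_v_rooted[OF F])
  have "card ?H = card (y_bot ` ?H)"
    by (rule card_image[symmetric]) (rule packed_inj_h_rooted[OF F])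
  also have "\<dots> \<le> height F - 1" using card_mono[OF _ H] by simp
  finally have cH: "card ?H \<le> height F - 1" .
  have "b = c" if "b \<in> ?C" "c \<in> ?C" for b c
    using that tiling_eq[OF t, of b c 0 0] tiling_block(1,3)[OF t, of b] tiling_block(1,3)[OF t, of c]
    by simp
  then have cC: "card ?C \<le> 1"
    using card_le_Suc0_iff_eq[OF fin(3)] by simp
  have "blocks F \<subseteq> ?V \<union> ?H \<union> ?C"
    using tiling_rooted[OF t] by blast
  then have "card (blocks F) \<le> card (?V \<union> ?H \<union> ?C)"
    using fin by (intro card_mono) auto
  also have "\<dots> \<le> card ?V + card ?H + card ?C"
    using card_Un_le[of "?V \<union> ?H" ?C] card_Un_le[of ?V ?H] by linarith
  finally have "card (blocks F) \<le> card ?V + card ?H + card ?C" .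
  moreover have "1 \<le> height F" "card (blocks F) = height F + width F - 1"
    using F unfolding packed_floorplan_iff by blast+
  ultimately have "width F - 1 \<le> card ?V" using cH cC by linarith
  then have "x_left ` ?V = {1..<width F}"
    using card_seteq[OF _ V] cV by simp
  then have "x \<in> x_left ` ?V" using x by simp
  then show thesis using that by blast
qed

section \<open>Transposition\<close>

definition flip_block :: "block \<Rightarrow> block" where
  "flip_block b = \<lparr>x_left = y_bot b, x_right = y_top b, y_bot = x_left b, y_top = x_right b\<rparr>"

definition flip :: "floorplan \<Rightarrow> floorplan" where
  "flip F = \<lparr>width = height F, height = width F, blocks = flip_block ` blocks F\<rparr>"

lemma flip_block_simps [simp]:
  "x_left (flip_block b) = y_bot b" "x_right (flip_block b) = y_top b"
  "y_bot (flip_block b) = x_left b" "y_top (flip_block b) = x_right b"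
  "flip_block (flip_block b) = b"
  by (simp_all add: flip_block_def)

lemma flip_simps [simp]:
  "width (flip F) = height F" "height (flip F) = width F"
  "blocks (flip F) = flip_block ` blocks F" "flip (flip F) = F"
  by (simp_all add: flip_def image_image)

lemma inj_flip_block: "inj flip_block"
  by (rule inj_on_inverseI[of _ flip_block]) simp

lemma tilingI:
  assumes "\<And>b. b \<in> blocks F \<Longrightarrow>
      x_left b < x_right b \<and> y_bot b < y_top b \<and> x_right b \<le> width F \<and> y_top b \<le> height F"
    and "\<And>i j. i < width F \<Longrightarrow> j < height F \<Longrightarrow>
      \<exists>b \<in> blocks F. x_left b \<le> i \<and> i < x_right b \<and> y_bot b \<le> j \<and> j < y_top b"
    and "\<And>b c i j. b \<in> blocks F \<Longrightarrow> c \<in> blocks F \<Longrightarrow>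
      x_left b \<le> i \<Longrightarrow> i < x_right b \<Longrightarrow> y_bot b \<le> j \<Longrightarrow> j < y_top b \<Longrightarrow>
      x_left c \<le> i \<Longrightarrow> i < x_right c \<Longrightarrow> y_bot c \<le> j \<Longrightarrow> j < y_top c \<Longrightarrow> b = c"
  shows "tiling F"
  unfolding tiling_def nondegenerate_def mem_cells
  using assms(1,2) by (intro conjI ballI allI impI; (elim conjE)?) (simp_all, rule assms(3))

lemma tiling_flip:
  assumes F: "tiling F"
  shows "tiling (flip F)"
proof (rule tilingI)
  fix b assume "b \<in> blocks (flip F)"
  then obtain b' where b: "b' \<in> blocks F" "b = flip_block b'" by auto
  then show "x_left b < x_right b \<and> y_bot b < y_top b \<and>
      x_right b \<le> width (flip F) \<and> y_top b \<le> height (flip F)"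
    using tiling_block[OF F b(1)] by simp
  fix c i j assume "c \<in> blocks (flip F)"
    and ij: "x_left b \<le> i" "i < x_right b" "y_bot b \<le> j" "j < y_top b"
      "x_left c \<le> i" "i < x_right c" "y_bot c \<le> j" "j < y_top c"
  then obtain c' where c: "c' \<in> blocks F" "c = flip_block c'" by auto
  show "b = c"
    using tiling_eq[OF F b(1) c(1), of j i] ij b(2) c(2) by simp
next
  fix i j assume "i < width (flip F)" "j < height (flip F)"
  then obtain b where b: "b \<in> blocks F" "x_left b \<le> j" "j < x_right b" "y_bot b \<le> i" "i < y_top b"
    using tiling_cover[OF F, of j i] by auto
  then show "\<exists>b \<in> blocks (flip F). x_left b \<le> i \<and> i < x_right b \<and> y_bot b \<le> j \<and> j < y_top b"
    by (intro bexI[of _ "flip_block b"]) auto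
qed

text \<open>Reflection turns the excluded position of the pair \<open>(b, c)\<close> into that of
  \<open>(c, b)\<close>, so the packing condition is preserved.\<close>

lemma packed_flip:
  assumes "packed_floorplan F"
  shows "packed_floorplan (flip F)"
proof -
  have "card (flip_block ` blocks F) = card (blocks F)"
    by (rule card_image) (metis inj_flip_block inj_on_subset subset_UNIV)
  then show ?thesis
    using assms tiling_flip[of F] unfolding packed_floorplan_iff by auto
qed

lemma h_edge_flip [simp]: "h_edge (flip F) = v_edge F"
  by (intro ext) (auto simp: h_edge_def v_edge_def)

lemma v_edge_flip [simp]: "v_edge (flip F) = h_edge F"
  by (intro ext) (auto simp: h_edge_def v_edge_def)

lemma internal_hseg_flip [simp]: "internal_hseg (flip F) = internal_vseg F"
  by (intro ext) (simp add: internal_hseg_def internal_vseg_def)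

lemma internal_vseg_flip [simp]: "internal_vseg (flip F) = internal_hseg F"
  by (intro ext) (simp add: internal_hseg_def internal_vseg_def)

lemma flip_add_right: "flip (add_right F y) = add_top (flip F) y"
proof -
  have "flip_block (if x_right b = width F \<and> y_top b \<le> y then b\<lparr>x_right := width F + 1\<rparr> else b) =
      (if y_top (flip_block b) = width F \<and> x_right (flip_block b) \<le> y
       then flip_block b\<lparr>y_top := width F + 1\<rparr> else flip_block b)" for b
    by (simp add: flip_block_def)
  moreover have "flip_block \<lparr>x_left = a, x_right = b, y_bot = c, y_top = d\<rparr> =
      \<lparr>x_left = c, x_right = d, y_bot = a, y_top = b\<rparr>" for a b c d
    by (simp add: flip_block_def)
  ultimately show ?thesis
    unfolding flip_def add_right_def add_top_def
    by (simp only: floorplan.simps image_insert image_image)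
qed

lemma flip_add_top: "flip (add_top F x) = add_right (flip F) x"
  by (metis flip_add_right flip_simps(4))

lemma add_top_eq_flip: "add_top F x = flip (add_right (flip F) x)"
  by (simp add: flip_add_right)


section \<open>Edges and segments after adding a block\<close>

text \<open>Sides of the bounding rectangle are not internal segments, so the stopping point on the
  bottom border is always added separately as \<open>insert 0\<close>.\<close>

definition right_sites :: "floorplan \<Rightarrow> nat set" where
  "right_sites F = {y. \<exists>a. internal_hseg F y a (width F)}"

definition top_sites :: "floorplan \<Rightarrow> nat set" where
  "top_sites F = {x. \<exists>a. internal_vseg F x a (height F)}"

lemma right_sites_flip [simp]: "right_sites (flip F) = top_sites F"
  by (simp add: right_sites_def top_sites_def)

lemma top_sites_flip [simp]: "top_sites (flip F) = right_sites F"
  by (simp add: right_sites_def top_sites_def)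

text \<open>Any larger interval contains one of the two adjacent unit steps, so it suffices to test
  these. The case \<open>a = 0\<close> is split off because \<open>0 - 1 = 0\<close> on the
  naturals.\<close>

lemma maximal_run_iff:
  "maximal_run P a c \<longleftrightarrow>
     a < c \<and> (\<forall>i. a \<le> i \<longrightarrow> i < c \<longrightarrow> P i) \<and> (a = 0 \<or> \<not> P (a - 1)) \<and> \<not> P c"
  (is "?L \<longleftrightarrow> ?R")
proof
  assume L: ?L
  then have ac: "a < c" and P: "\<forall>i\<in>{a..<c}. P i"
    and max: "\<And>a' c'. a' \<le> a \<Longrightarrow> c \<le> c' \<Longrightarrow> \<forall>i\<in>{a'..<c'}. P i \<Longrightarrow> a' = a \<and> c' = c"
    unfolding maximal_run_def by blast+
  have "\<not> P c"
  proof
    assume "P c"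
    then have "\<forall>i\<in>{a..<Suc c}. P i" using P by (auto simp: less_Suc_eq)
    then show False using max[of a "Suc c"] by simp
  qed
  moreover have "\<not> P (a - 1)" if "a \<noteq> 0"
  proof
    assume "P (a - 1)"
    have "P i" if i: "i \<in> {a - 1..<c}" for i
    proof (cases "i = a - 1")
      case False
      then have "a \<le> i" using i by auto
      then show ?thesis using i P by simp
    qed (use \<open>P (a - 1)\<close> in simp)
    then show False using max[of "a - 1" c] that by simp
  qed
  ultimately show ?R using ac P by auto
next
  assume R: ?R
  show ?L
    unfolding maximal_run_def
  proof (intro conjI allI impI)
    fix a' c' assume h: "a' \<le> a \<and> c \<le> c' \<and> (\<forall>i\<in>{a'..<c'}. P i)"
    show "a' = a"
    proof (rule ccontr)
      assume "a' \<noteq> a"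
      then have "a - 1 \<in> {a'..<c'}" "a \<noteq> 0" using h R by auto
      then show False using h R by blast
    qed
    show "c' = c"
    proof (rule ccontr)
      assume "c' \<noteq> c"
      then have "c \<in> {a'..<c'}" using h R by auto
      then show False using h R by blast
    qed
  qed (use R in auto)
qed

text \<open>Models one grid line when the single unit position \<open>n\<close> is appended to its
  range. The premise \<open>last\<close> rules out a run consisting of \<open>n\<close> alone, so a
  new edge can only prolong a run that ended at \<open>n\<close>.\<close>

lemma maximal_run_append:
  assumes eq: "\<And>i. i < n \<Longrightarrow> Q i = P i" and P: "\<And>i. n \<le> i \<Longrightarrow> \<not> P i"
    and Q: "\<And>i. n < i \<Longrightarrow> \<not> Q i" and last: "Q n \<Longrightarrow> P (n - 1)" and n: "0 < n"
  shows "maximal_run Q a c \<longleftrightarrow>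
    c < n \<and> maximal_run P a c \<or> maximal_run P a n \<and> c = (if Q n then Suc n else n)"
proof -
  consider "c < n" | "c = n" | "c = Suc n" | "Suc n < c" by linarith
  then show ?thesis
  proof cases
    case 1
    have "a \<noteq> 0 \<Longrightarrow> a < c \<Longrightarrow> Q (a - 1) = P (a - 1)" using eq 1 by simp
    moreover have "(\<forall>i. a \<le> i \<longrightarrow> i < c \<longrightarrow> Q i) = (\<forall>i. a \<le> i \<longrightarrow> i < c \<longrightarrow> P i)"
      using eq 1 by (meson order.strict_trans)
    ultimately show ?thesis using 1 eq unfolding maximal_run_iff by auto
  next
    case 2
    have "a \<noteq> 0 \<Longrightarrow> a < c \<Longrightarrow> Q (a - 1) = P (a - 1)" using eq 2 by simp
    moreover have "(\<forall>i. a \<le> i \<longrightarrow> i < c \<longrightarrow> Q i) = (\<forall>i. a \<le> i \<longrightarrow> i < c \<longrightarrow> P i)"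
      using eq 2 by simp
    ultimately show ?thesis using 2 P[of n] unfolding maximal_run_iff by auto
  next
    case 3
    have *: "maximal_run Q a (Suc n) \<longleftrightarrow> maximal_run P a n" if Qn: "Q n"
    proof -
      have "a \<noteq> n" if "maximal_run Q a (Suc n)"
        using that last[OF Qn] eq[of "n - 1"] n unfolding maximal_run_iff by auto
      moreover have "a < Suc n \<Longrightarrow> a \<noteq> 0 \<Longrightarrow> Q (a - 1) = P (a - 1)" using eq by simp
      moreover have "(\<forall>i. a \<le> i \<longrightarrow> i < Suc n \<longrightarrow> Q i) = (\<forall>i. a \<le> i \<longrightarrow> i < n \<longrightarrow> P i)"
        using eq Qn by (auto simp: less_Suc_eq)
      ultimately show ?thesis
        using P[of n] Q[of "Suc n"] unfolding maximal_run_iff by (auto simp: less_Suc_eq)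
    qed
    have "Q n" if "maximal_run Q a (Suc n)"
      using that unfolding maximal_run_iff by simp
    then show ?thesis using * 3 by auto
  next
    case 4
    have "\<not> maximal_run Q a c"
    proof
      assume "maximal_run Q a c"
      then have "a < c" "\<forall>i. a \<le> i \<longrightarrow> i < c \<longrightarrow> Q i" unfolding maximal_run_iff by auto
      then have "Q (c - 1)" by simp
      moreover have "n < c - 1" using 4 by linarith
      ultimately show False using Q by blast
    qed
    then show ?thesis using 4 by simp
  qed
qed

lemma tiling_h_edge_lt: "tiling F \<Longrightarrow> h_edge F y i \<Longrightarrow> i < width F"
  unfolding h_edge_def using tiling_block(2) by (meson order.strict_trans2)

lemma tiling_v_edge_lt: "tiling F \<Longrightarrow> v_edge F x j \<Longrightarrow> j < height F"
  unfolding v_edge_def using tiling_block(4) by (meson order.strict_trans2)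

lemma tiling_internal_hseg_le: "tiling F \<Longrightarrow> internal_hseg F y a c \<Longrightarrow> c \<le> width F"
  unfolding internal_hseg_def maximal_run_iff
  using tiling_h_edge_lt[of F y "c - 1"] by auto

lemma tiling_internal_vseg_le: "tiling F \<Longrightarrow> internal_vseg F y a c \<Longrightarrow> c \<le> height F"
  unfolding internal_vseg_def maximal_run_iff
  using tiling_v_edge_lt[of F y "c - 1"] by auto

text \<open>The block carrying the edge owns the cell just above or just below it. If the line ran
  through the interior of \<open>b\<close>, that cell would also lie in \<open>b\<close>.\<close>

lemma tiling_h_edge_split:
  assumes F: "tiling F" and e: "h_edge F y i" and b: "b \<in> blocks F" "x_left b \<le> i" "i < x_right b"
  shows "y_top b \<le> y \<or> y \<le> y_bot b"
proof (rule ccontr)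
  assume n: "\<not> (y_top b \<le> y \<or> y \<le> y_bot b)"
  from e obtain c where c: "c \<in> blocks F" "y_bot c = y \<or> y_top c = y" "x_left c \<le> i" "i < x_right c"
    unfolding h_edge_def by blast
  note nc = tiling_block[OF F c(1)]
  from c(2) have "b = c"
  proof
    assume "y_bot c = y"
    then show ?thesis using tiling_eq[OF F b(1) c(1), of i y] b c n nc by simp
  next
    assume "y_top c = y"
    moreover have "y_bot b \<le> y - 1" "y - 1 < y_top b" "y_bot c \<le> y - 1" "y - 1 < y"
      using calculation n nc by linarith+
    ultimately show ?thesis using tiling_eq[OF F b(1) c(1), of i "y - 1"] b c by simp
  qed
  then show False using n c(2) by auto
qed

text \<open>A unit edge at the border extends to a segment whose left end is the least point from
  which the edges are unbroken up to the border; no edge lies beyond the border.\<close>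

lemma right_sites_iff:
  assumes F: "tiling F" and w: "0 < width F"
  shows "y \<in> right_sites F \<longleftrightarrow> 0 < y \<and> y < height F \<and> h_edge F y (width F - 1)"
proof
  assume "y \<in> right_sites F"
  then obtain a where "0 < y" "y < height F" "maximal_run (h_edge F y) a (width F)"
    unfolding right_sites_def internal_hseg_def by blast
  then show "0 < y \<and> y < height F \<and> h_edge F y (width F - 1)"
    unfolding maximal_run_iff using w by auto
next
  assume y: "0 < y \<and> y < height F \<and> h_edge F y (width F - 1)"
  define a where "a = (LEAST a. \<forall>i. a \<le> i \<longrightarrow> i < width F \<longrightarrow> h_edge F y i)"
  let ?A = "\<lambda>a. \<forall>i. a \<le> i \<longrightarrow> i < width F \<longrightarrow> h_edge F y i"
  have last: "?A (width F - 1)"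
  proof (intro allI impI)
    fix i assume "width F - 1 \<le> i" "i < width F"
    then have "i = width F - 1" by simp
    then show "h_edge F y i" using y by simp
  qed
  have a: "?A a" unfolding a_def by (rule LeastI[of ?A, OF last])
  have aw: "a < width F" using Least_le[of ?A, OF last] w unfolding a_def by simp
  have "\<not> h_edge F y (a - 1)" if "a \<noteq> 0"
  proof
    assume e: "h_edge F y (a - 1)"
    have "?A (a - 1)"
    proof (intro allI impI)
      fix i assume "a - 1 \<le> i" "i < width F"
      then show "h_edge F y i" using a e by (cases "i = a - 1") auto
    qed
    then have "a \<le> a - 1" unfolding a_def by (rule Least_le[of ?A])
    then show False using that by simp
  qed
  moreover have "\<not> h_edge F y (width F)" using tiling_h_edge_lt[OF F, of y "width F"] by auto
  ultimately have "maximal_run (h_edge F y) a (width F)"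
    unfolding maximal_run_iff using a aw by blast
  then show "y \<in> right_sites F" unfolding right_sites_def internal_hseg_def using y by blast
qed

section \<open>Edges and segments after an addition on the right\<close>

definition widen :: "floorplan \<Rightarrow> nat \<Rightarrow> block \<Rightarrow> block" where
  "widen F y b = (if x_right b = width F \<and> y_top b \<le> y then b\<lparr>x_right := width F + 1\<rparr> else b)"

definition right_block :: "floorplan \<Rightarrow> nat \<Rightarrow> block" where
  "right_block F y = \<lparr>x_left = width F, x_right = width F + 1, y_bot = y, y_top = height F\<rparr>"

lemma add_right_simps [simp]:
  "width (add_right F y) = Suc (width F)" "height (add_right F y) = height F"
  "blocks (add_right F y) = insert (right_block F y) (widen F y ` blocks F)"
  by (auto simp: add_right_def right_block_def widen_def)

lemma add_top_simps [simp]: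
  "width (add_top F x) = width F" "height (add_top F x) = Suc (height F)"
  by (auto simp: add_top_def)

lemma widen_simps [simp]:
  "x_left (widen F y b) = x_left b" "y_bot (widen F y b) = y_bot b" "y_top (widen F y b) = y_top b"
  "x_right (widen F y b) =
     (if x_right b = width F \<and> y_top b \<le> y then Suc (width F) else x_right b)"
  by (auto simp: widen_def)

lemma right_block_simps [simp]:
  "x_left (right_block F y) = width F" "x_right (right_block F y) = Suc (width F)"
  "y_bot (right_block F y) = y" "y_top (right_block F y) = height F"
  by (auto simp: right_block_def)

lemma h_edge_add_right_less:
  assumes "i < width F"
  shows "h_edge (add_right F y) z i = h_edge F z i"
proof -
  have "i < x_right (widen F y b) \<longleftrightarrow> i < x_right b" for b using assms by auto
  then show ?thesis
    using assms by (simp add: h_edge_def del: widen_simps(4))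
qed

lemma v_edge_add_right_less:
  assumes "x < width F"
  shows "v_edge (add_right F y) x j = v_edge F x j"
proof -
  have "x_right (widen F y b) = x \<longleftrightarrow> x_right b = x" for b using assms by auto
  then show ?thesis
    using assms by (simp add: v_edge_def del: widen_simps(4))
qed

text \<open>Covers every stopping point of the procedure, including those that create a forbidden
  configuration. Instantiated with \<open>flip F\<close>, it describes additions on top.\<close>

locale right_addition =
  fixes F :: floorplan and y :: nat
  assumes tiling: "tiling F" and width: "0 < width F" and height: "0 < height F"
    and site: "y \<in> insert 0 (right_sites F)"
begin

lemma y_less: "y < height F"
  using site right_sites_iff[OF tiling width] height by auto

text \<open>Allows the bottom border and the internal sites to be treated alike: in both cases a
  line at height \<open>y\<close> reaches the right border.\<close>

lemma y_edge: "h_edge F y (width F - 1)"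
proof (cases "y = 0")
  case True
  obtain b where b: "b \<in> blocks F" "x_left b \<le> width F - 1" "width F - 1 < x_right b"
      "y_bot b \<le> 0"
    by (rule tiling_cover[OF tiling, of "width F - 1" 0]) (use width height in auto)
  then show ?thesis unfolding h_edge_def using True by auto
next
  case False
  then show ?thesis using site right_sites_iff[OF tiling width] by auto
qed

text \<open>No block on the right border straddles height \<open>y\<close>, so the border blocks
  that \<open>widen\<close> leaves unchanged are exactly those lying above the stopping
  point.\<close>

lemma border_block:
  assumes "b \<in> blocks F" "x_right b = width F"
  shows "y_top b \<le> y \<or> y \<le> y_bot b"
  by (rule tiling_h_edge_split[OF tiling y_edge assms(1)])
    (use tiling_block[OF tiling assms(1)] assms(2) in auto)

text \<open>The new column consists of the new block above \<open>y\<close> and of widened blocks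
  below it. The edge at \<open>y\<close> itself is the bottom side of the new block.\<close>

lemma h_edge_last:
  "h_edge (add_right F y) z (width F) \<longleftrightarrow> z = height F \<or> z \<le> y \<and> h_edge F z (width F - 1)"
proof
  assume "h_edge (add_right F y) z (width F)"
  then obtain b where b: "b = right_block F y \<or> b \<in> widen F y ` blocks F"
      "y_bot b = z \<or> y_top b = z" "x_left b \<le> width F" "width F < x_right b"
    unfolding h_edge_def add_right_simps by blast
  from b(1) show "z = height F \<or> z \<le> y \<and> h_edge F z (width F - 1)"
  proof
    assume "b = right_block F y"
    then show ?thesis using b(2) y_edge by auto
  next
    assume "b \<in> widen F y ` blocks F"
    then obtain c where c: "c \<in> blocks F" "b = widen F y c" by blast
    note nc = tiling_block[OF tiling c(1)]
    have cr: "x_right c = width F" "y_top c \<le> y"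
      using b(4) nc unfolding c(2) by (auto split: if_splits)
    have z: "y_bot c = z \<or> y_top c = z" using b(2) unfolding c(2) by simp
    then have "h_edge F z (width F - 1)"
      unfolding h_edge_def using c(1) cr nc by (intro bexI[of _ c]) auto
    moreover have "z \<le> y" using z cr nc by auto
    ultimately show ?thesis by simp
  qed
next
  assume h: "z = height F \<or> z \<le> y \<and> h_edge F z (width F - 1)"
  show "h_edge (add_right F y) z (width F)"
  proof (cases "z = height F \<or> z = y")
    case True
    then show ?thesis unfolding h_edge_def by (intro bexI[of _ "right_block F y"]) auto
  next
    case False
    then obtain b where zy: "z < y" and b: "b \<in> blocks F" "y_bot b = z \<or> y_top b = z"
        "x_left b \<le> width F - 1" "width F - 1 < x_right b"
      using h unfolding h_edge_def by auto
    note nb = tiling_block[OF tiling b(1)]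
    have r: "x_right b = width F" using b nb by simp
    have "y_top b \<le> y" using border_block[OF b(1) r] b(2) zy nb by auto
    then show ?thesis
      unfolding h_edge_def using b nb r by (intro bexI[of _ "widen F y b"]) auto
  qed
qed

text \<open>Besides the new block, only border blocks that stay unwidened still have a side on the
  old border line, and these lie above \<open>y\<close>.\<close>

lemma v_edge_width: "v_edge (add_right F y) (width F) j \<longleftrightarrow> y \<le> j \<and> j < height F"
proof
  assume "v_edge (add_right F y) (width F) j"
  then obtain b where b: "b = right_block F y \<or> b \<in> widen F y ` blocks F"
      "x_left b = width F \<or> x_right b = width F" "y_bot b \<le> j" "j < y_top b"
    unfolding v_edge_def add_right_simps by blast
  from b(1) show "y \<le> j \<and> j < height F"
  proof
    assume "b = right_block F y"
    then show ?thesis using b by auto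
  next
    assume "b \<in> widen F y ` blocks F"
    then obtain c where c: "c \<in> blocks F" "b = widen F y c" by blast
    note nc = tiling_block[OF tiling c(1)]
    have "x_right c = width F" "\<not> y_top c \<le> y"
      using b(2) nc unfolding c(2) by (auto split: if_splits)
    then show ?thesis using border_block[OF c(1)] b(3,4) nc unfolding c(2) by auto
  qed
next
  assume "y \<le> j \<and> j < height F"
  then show "v_edge (add_right F y) (width F) j"
    unfolding v_edge_def by (intro bexI[of _ "right_block F y"]) auto
qed

text \<open>An instance of \<open>maximal_run_append\<close> with \<open>n = width F\<close>: a site
  up to \<open>y\<close> is prolonged across the new column, a higher one now ends on the new left
  side.\<close>

lemma internal_hseg_add_right:
  "internal_hseg (add_right F y) z a c \<longleftrightarrow>
     c < width F \<and> internal_hseg F z a c \<or>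
     internal_hseg F z a (width F) \<and> c = (if z \<le> y then Suc (width F) else width F)"
proof (cases "0 < z \<and> z < height F")
  case True
  let ?P = "h_edge F z" and ?Q = "h_edge (add_right F y) z"
  have run: "maximal_run ?Q a c \<longleftrightarrow>
      c < width F \<and> maximal_run ?P a c \<or>
      maximal_run ?P a (width F) \<and> c = (if ?Q (width F) then Suc (width F) else width F)"
  proof (rule maximal_run_append)
    show "?Q i = ?P i" if "i < width F" for i using h_edge_add_right_less[OF that] .
    show "\<not> ?P i" if "width F \<le> i" for i using tiling_h_edge_lt[OF tiling] that by force
    show "\<not> ?Q i" if "width F < i" for i
    proof
      assume "?Q i"
      then obtain b where "b \<in> blocks (add_right F y)" "i < x_right b"
        unfolding h_edge_def by blast
      then show False using that tiling_block(2)[OF tiling] by (fastforce split: if_splits)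
    qed
    show "?P (width F - 1)" if "?Q (width F)" using that h_edge_last True by simp
    show "0 < width F" by (rule width)
  qed
  have "?Q (width F) \<longleftrightarrow> z \<le> y" if "maximal_run ?P a (width F)"
    using that True width h_edge_last[of z] unfolding maximal_run_iff by auto
  then show ?thesis
    unfolding internal_hseg_def using run True by auto
qed (auto simp: internal_hseg_def)

lemma internal_vseg_add_right:
  "internal_vseg (add_right F y) x a c \<longleftrightarrow>
     internal_vseg F x a c \<or> x = width F \<and> a = y \<and> c = height F"
proof (cases "x = width F")
  case True
  have e: "v_edge (add_right F y) (width F) = (\<lambda>j. y \<le> j \<and> j < height F)"
    using v_edge_width by blast
  have "maximal_run (\<lambda>j. y \<le> j \<and> j < height F) a c \<longleftrightarrow> a = y \<and> c = height F"
  proof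
    assume r: "maximal_run (\<lambda>j. y \<le> j \<and> j < height F) a c"
    then have "a < c" "\<forall>i. a \<le> i \<longrightarrow> i < c \<longrightarrow> y \<le> i \<and> i < height F"
      "a = 0 \<or> \<not> (y \<le> a - 1 \<and> a - 1 < height F)" "\<not> (y \<le> c \<and> c < height F)"
      unfolding maximal_run_iff by blast+
    moreover from this(1,2) have "y \<le> a" "a < height F" "c - 1 < height F" by auto
    ultimately show "a = y \<and> c = height F" by linarith
  next
    assume "a = y \<and> c = height F"
    then show "maximal_run (\<lambda>j. y \<le> j \<and> j < height F) a c"
      unfolding maximal_run_iff using y_less by auto
  qed
  then show ?thesis using True width unfolding internal_vseg_def by (auto simp: e)
next
  case False
  have "v_edge (add_right F y) x = v_edge F x" if "x < width F"
    using v_edge_add_right_less[OF that] by blast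
  then show ?thesis using False unfolding internal_vseg_def by auto
qed

end

section \<open>Packed floorplans and block addition\<close>

context right_addition
begin

text \<open>Widening keeps the bottom-left corner, and this corner determines a block of a
  tiling.\<close>

lemma inj_widen: "inj_on (widen F y) (blocks F)"
proof (rule inj_onI)
  fix b c assume b: "b \<in> blocks F" and c: "c \<in> blocks F" and e: "widen F y b = widen F y c"
  have "x_left b = x_left c" "y_bot b = y_bot c" using e by (metis widen_simps(1,2))+
  then show "b = c"
    using tiling_eq[OF tiling b c, of "x_left b" "y_bot b"]
      tiling_block(1,3)[OF tiling b] tiling_block(1,3)[OF tiling c] by simp
qed

lemma right_block_notin_widen: "right_block F y \<notin> widen F y ` blocks F"
proof
  assume "right_block F y \<in> widen F y ` blocks F"
  then obtain b where b: "b \<in> blocks F" "right_block F y = widen F y b" by blast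
  then have "x_left b = width F" by (metis widen_simps(1) right_block_simps(1))
  then show False using tiling_block(1,2)[OF tiling b(1)] by simp
qed

lemma tiling_add_right: "tiling (add_right F y)"
proof (rule tilingI)
  fix b assume "b \<in> blocks (add_right F y)"
  then consider "b = right_block F y" | c where "c \<in> blocks F" "b = widen F y c" by auto
  then show "x_left b < x_right b \<and> y_bot b < y_top b \<and>
      x_right b \<le> width (add_right F y) \<and> y_top b \<le> height (add_right F y)"
  proof cases
    case 1
    then show ?thesis using y_less by simp
  next
    case 2
    then show ?thesis using tiling_block[OF tiling 2(1)] by auto
  qed
next
  fix i j assume ij: "i < width (add_right F y)" "j < height (add_right F y)"
  show "\<exists>b \<in> blocks (add_right F y). x_left b \<le> i \<and> i < x_right b \<and> y_bot b \<le> j \<and> j < y_top b"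
  proof (cases "i = width F \<and> y \<le> j")
    case True
    then show ?thesis using ij by (intro bexI[of _ "right_block F y"]) simp_all
  next
    case False
    \<comment> \<open>The map from \<open>i\<close> to \<open>min i (width F - 1)\<close> sends a
      cell of the new column to its neighbour in the old last column and fixes all other
      cells.\<close>
    have "min i (width F - 1) < width F" "j < height F" using width ij by auto
    then obtain b where b: "b \<in> blocks F" "x_left b \<le> min i (width F - 1)"
        "min i (width F - 1) < x_right b" "y_bot b \<le> j" "j < y_top b"
      by (rule tiling_cover[OF tiling])
    have "i < x_right (widen F y b)"
    proof (cases "i = width F")
      case True
      then have "x_right b = width F" using b(3) tiling_block(2)[OF tiling b(1)] by auto
      moreover have "y_top b \<le> y" using border_block[OF b(1) calculation] False True b(4) by auto
      ultimately show ?thesis using True by simp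
    next
      case False
      then have "min i (width F - 1) = i" using ij by auto
      then show ?thesis using b(3) ij False by auto
    qed
    moreover have "x_left b \<le> i" using b(2) by simp
    ultimately show ?thesis using b(1,4,5) by (intro bexI[of _ "widen F y b"]) simp_all
  qed
next
  fix b c i j assume bc: "b \<in> blocks (add_right F y)" "c \<in> blocks (add_right F y)"
    and ij: "x_left b \<le> i" "i < x_right b" "y_bot b \<le> j" "j < y_top b"
      "x_left c \<le> i" "i < x_right c" "y_bot c \<le> j" "j < y_top c"
  \<comment> \<open>A widened block that reaches the new column stays below \<open>y\<close>, so it
    misses the new block.\<close>
  have widened: "j < y"
    if "e \<in> blocks F" "width F \<le> i" "i < x_right (widen F y e)" "j < y_top e" for e
    using that tiling_block(2)[OF tiling that(1)] by (auto split: if_splits)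
  have *: "x_left e \<le> min i (width F - 1) \<and> min i (width F - 1) < x_right e"
    if "e \<in> blocks F" "x_left e \<le> i" "i < x_right (widen F y e)" for e
    using that tiling_block(1,2)[OF tiling that(1)] by (auto split: if_splits)
  from bc consider "b = right_block F y" "c = right_block F y"
    | c' where "c' \<in> blocks F" "b = right_block F y" "c = widen F y c'"
    | b' where "b' \<in> blocks F" "c = right_block F y" "b = widen F y b'"
    | b' c' where "b' \<in> blocks F" "c' \<in> blocks F" "b = widen F y b'" "c = widen F y c'"
    unfolding add_right_simps by blast
  then show "b = c"
  proof cases
    case 1
    then show ?thesis by simp
  next
    case (2 c')
    then show ?thesis using widened[of c'] ij by simp
  next
    case (3 b')
    then show ?thesis using widened[of b'] ij by simp
  next
    case (4 b' c')
    then have "b' = c'"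
      using tiling_eq[OF tiling 4(1,2), of "min i (width F - 1)" j] *[of b'] *[of c'] ij
      by (simp del: widen_simps(4))
    then show ?thesis using 4 by simp
  qed
qed

text \<open>The new block is not the left member of an excluded pair, as no block starts beyond
  \<open>width F\<close>, nor the right member, as its top lies on the top border. For two old
  blocks, widening only moves right ends further to the right and so creates no excluded
  pair.\<close>

lemma packed_add_right:
  assumes F: "packed_floorplan F"
  shows "packed_floorplan (add_right F y)"
  unfolding packed_floorplan_iff
proof (intro conjI ballI impI)
  show "1 \<le> width (add_right F y)" by simp
  show "1 \<le> height (add_right F y)" using height by simp
  show "tiling (add_right F y)" by (rule tiling_add_right)
  have "card (blocks (add_right F y)) = Suc (card (blocks F))"
    using right_block_notin_widen packed_finite[OF F] card_image[OF inj_widen] by simp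
  then show "card (blocks (add_right F y)) = height (add_right F y) + width (add_right F y) - 1"
    using F width unfolding packed_floorplan_iff by simp
  fix b c assume bc: "b \<in> blocks (add_right F y)" "c \<in> blocks (add_right F y)"
    and h: "x_right b \<le> x_left c" "y_top c \<le> y_bot b"
  have c_le: "x_left c \<le> width F"
    using bc(2) tiling_block(1,2)[OF tiling] by fastforce
  have "b \<noteq> right_block F y" using h(1) c_le by auto
  then obtain b' where b': "b' \<in> blocks F" "b = widen F y b'" using bc(1) by auto
  note nb = tiling_block[OF tiling b'(1)]
  have "c \<noteq> right_block F y" using h(2) b'(2) nb by auto
  then obtain c' where c': "c' \<in> blocks F" "c = widen F y c'" using bc(2) by auto
  have "x_right b' \<le> x_left c'"
    using h(1) b'(2) c'(2) by (auto split: if_splits)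
  then show False using packed_no_lower_right[OF F b'(1) c'(1)] h(2) b'(2) c'(2) by simp
qed

end

section \<open>Undoing a block addition\<close>

lemma block_eqI:
  fixes b c :: block
  assumes "x_left b = x_left c" "x_right b = x_right c" "y_bot b = y_bot c" "y_top b = y_top c"
  shows "b = c"
  using assms by (intro block.equality) simp_all

lemma floorplan_eqI:
  fixes F G :: floorplan
  assumes "width F = width G" "height F = height G" "blocks F = blocks G"
  shows "F = G"
  using assms by (intro floorplan.equality) simp_all

text \<open>Both data can be read off the result: \<open>y\<close> is the lower end of the edges on
  the old border line, and the old blocks are those that start left of this line, truncated at
  it.\<close>

lemma add_right_inject:
  assumes "right_addition F y" "right_addition F' y'" and eq: "add_right F y = add_right F' y'"
  shows "F = F' \<and> y = y'"
proof -
  interpret A: right_addition F y by fact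
  interpret B: right_addition F' y' by fact
  have w: "width F = width F'" and h: "height F = height F'"
    using arg_cong[OF eq, of width] arg_cong[OF eq, of height] by simp_all
  have "y \<le> j \<and> j < height F \<longleftrightarrow> y' \<le> j \<and> j < height F" for j
    using A.v_edge_width[of j] B.v_edge_width[of j] eq w h by simp
  from this[of y] this[of y'] have y: "y = y'" using A.y_less B.y_less h by auto
  define narrow where "narrow b = b\<lparr>x_right := min (x_right b) (width F)\<rparr>" for b :: block
  have rec: "blocks E = narrow ` {b \<in> blocks (add_right E y). x_left b < width F}"
    if E: "tiling E" "width E = width F" for E
  proof -
    have "narrow (widen E y b) = b" "x_left b < width F" if "b \<in> blocks E" for b
      using tiling_block(1,2)[OF E(1) that] E(2)
      by (auto simp: narrow_def intro!: block_eqI)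
    then have "narrow ` (widen E y ` blocks E) = blocks E"
      "{b \<in> blocks (add_right E y). x_left b < width F} = widen E y ` blocks E"
      using E(2) by (auto simp: image_image)
    then show ?thesis by simp
  qed
  have "blocks F = blocks F'"
    using rec[OF A.tiling refl] rec[OF B.tiling w[symmetric]] eq y by (simp del: add_right_simps)
  then show ?thesis using w h y by (auto intro: floorplan_eqI)
qed

text \<open>The new block would have to be the unit cell in the north-east corner for both
  additions. The vertical site on which its bottom side stops continues below the lower left corner
  of this cell, but the left side created by the right addition has to end there.\<close>

lemma add_right_neq_add_top:
  assumes "right_addition F y" "right_addition (flip F') x"
  shows "add_right F y \<noteq> add_top F' x"
proof
  assume eq: "add_right F y = add_top F' x"
  interpret A: right_addition F y by fact
  interpret B: right_addition "flip F'" x by fact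
  have w: "width F' = Suc (width F)" and h: "height F = Suc (height F')"
    using arg_cong[OF eq, of width] arg_cong[OF eq, of height] by simp_all
  have flip: "add_right (flip F') x = flip (add_right F y)" by (simp add: eq flip_add_top)
  have "v_edge (add_right F y) (width F) (height F')"
    using A.v_edge_width A.y_less h by simp
  \<comment> \<open>In its new row, a top addition has vertical edges only up to \<open>x\<close>,
    apart from the right border; the left side of the right addition passes through this
    row.\<close>
  then have "width F \<le> x"
    using B.h_edge_last[of "width F"] w unfolding flip by simp
  then have x: "x = width F" using B.y_less w by simp
  have "h_edge (add_right F y) (height F') (width F)"
    using B.v_edge_width[of "width F"] w x unfolding flip by simp
  then have "height F' \<le> y" using A.h_edge_last[of "height F'"] h by simp
  then have y: "y = height F'" using A.y_less h by simp
  have "v_edge F' x (height F' - 1)" using B.y_edge by simp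
  then have "v_edge (add_right F y) x (height F' - 1)"
    using h_edge_add_right_less[of "height F' - 1" "flip F'" x x] B.width unfolding flip by simp
  then have "y \<le> height F' - 1" using A.v_edge_width x by simp
  then show False using y B.width by simp
qed

text \<open>Once the corner block is known to have width 1, deleting it and narrowing the blocks
  beneath it inverts an addition. The witness \<open>c\<close> of \<open>v_rooted\<close> makes
  packing effective: any block to the right of \<open>c\<close> rises above
  \<open>y\<close>.\<close>

lemma right_parent:
  assumes G: "packed_floorplan G" and b: "b \<in> blocks G" "v_rooted G b"
    and corner: "x_right b = width G" "y_top b = height G"
  obtains F y where "packed_floorplan F" "y \<in> insert 0 (right_sites F)" "G = add_right F y"
proof -
  note t = packed_tiling[OF G]
  note nb = tiling_block[OF t b(1)]
  define y where "y = y_bot b"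
  define m where "m = width G - 1"
  from b(2) obtain c where c: "c \<in> blocks G" "x_right c = x_left b" "y_bot c = y"
    unfolding v_rooted_def y_def by blast
  note nc = tiling_block[OF t c(1)]
  have w: "width G = Suc m" "0 < m" using nb nc c(2) corner unfolding m_def by auto
  have left: "x_left b = m"
  proof (rule ccontr)
    assume "x_left b \<noteq> m"
    \<comment> \<open>Otherwise the next vertical line is an inner one and carries the left side of
      some block \<open>e\<close>, which rises above \<open>y\<close> and therefore overlaps
      \<open>b\<close>.\<close>
    then have lt: "Suc (x_left b) < width G" using nb corner w by simp
    obtain e where e: "e \<in> blocks G" "x_left e = Suc (x_left b)"
      by (rule packed_v_rooted_exists[OF G _ lt]) auto
    note ne = tiling_block[OF t e(1)]
    have ye: "y < y_top e"
      using packed_no_lower_right[OF G c(1) e(1)] c(2,3) e(2) by simp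
    have "b = e"
      by (rule tiling_eq[OF t b(1) e(1), of "Suc (x_left b)" "y_top e - 1"])
        (use ye ne e(2) corner lt y_def in auto)
    then show False using e(2) by simp
  qed
  have right_of: "y_top e \<le> y" if e: "e \<in> blocks G" "e \<noteq> b" "m < x_right e" for e
  proof (rule ccontr)
    assume n: "\<not> y_top e \<le> y"
    note ne = tiling_block[OF t e(1)]
    have "b = e"
      by (rule tiling_eq[OF t b(1) e(1), of m "y_top e - 1"])
        (use n ne nb e(3) left corner w y_def in auto)
    then show False using e by simp
  qed
  have left_of: "x_left e < m" if e: "e \<in> blocks G" "e \<noteq> b" for e
  proof (rule ccontr)
    assume n: "\<not> x_left e < m"
    then have "m < x_right e" using tiling_block(1)[OF t e(1)] by simp
    moreover have "y < y_top e"
      using packed_no_lower_right[OF G c(1) e(1)] c(2,3) n left by simp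
    ultimately show False using right_of[OF e] by simp
  qed
  \<comment> \<open>This keeps \<open>widen\<close> from touching blocks that already ended at
    \<open>m\<close> in \<open>G\<close>: the block to the right of such a low block would start
    before \<open>m\<close> and overlap it.\<close>
  have inner: "y < y_top e" if e: "e \<in> blocks G" "x_right e = m" for e
  proof (rule ccontr)
    assume n: "\<not> y < y_top e"
    note ne = tiling_block[OF t e(1)]
    have "m < width G" "y_bot e < height G" using w ne by auto
    then obtain e' where e': "e' \<in> blocks G" "x_left e' \<le> m" "m < x_right e'"
        "y_bot e' \<le> y_bot e" "y_bot e < y_top e'"
      by (rule tiling_cover[OF t])
    have "e' \<noteq> b" using e'(4) n ne y_def by auto
    then have "x_left e' < m" using left_of e'(1) by simp
    then have "x_left e' \<le> m - 1" "m - 1 < x_right e'" "x_left e \<le> m - 1" "m - 1 < x_right e"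
      using e'(3) e(2) ne w(2) by linarith+
    then have "e = e'"
      using tiling_eq[OF t e(1) e'(1), of "m - 1" "y_bot e"] e'(4,5) ne by simp
    then show False using e(2) e'(3) by simp
  qed
  define narrow where "narrow e = (if x_right e = Suc m then e\<lparr>x_right := m\<rparr> else e)" for e :: block
  have narrow_simps [simp]: "x_left (narrow e) = x_left e" "y_bot (narrow e) = y_bot e"
    "y_top (narrow e) = y_top e" "x_right (narrow e) = (if x_right e = Suc m then m else x_right e)" for e
    by (auto simp: narrow_def)
  define F where "F = \<lparr>width = m, height = height G, blocks = narrow ` (blocks G - {b})\<rparr>"
  have F_simps [simp]: "width F = m" "height F = height G" "blocks F = narrow ` (blocks G - {b})"
    by (simp_all add: F_def)
  have widen: "widen F y (narrow e) = e" if e: "e \<in> blocks G - {b}" for e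
    using right_of[of e] inner[of e] e
    by (intro block_eqI) (auto simp: not_le)
  have "right_block F y = b"
    using left corner w y_def by (intro block_eqI) simp_all
  then have GF: "G = add_right F y"
    using widen b(1) w
    by (intro floorplan_eqI) (auto simp: image_image insert_absorb)
  have tF: "tiling F"
  proof (rule tilingI)
    fix e assume "e \<in> blocks F"
    then obtain e' where e': "e' \<in> blocks G" "e' \<noteq> b" "e = narrow e'" by auto
    note ne' = tiling_block[OF t e'(1)]
    show "x_left e < x_right e \<and> y_bot e < y_top e \<and> x_right e \<le> width F \<and> y_top e \<le> height F"
      using ne' left_of[OF e'(1,2)] w e'(3) by auto
    fix f i j assume "f \<in> blocks F"
      and ij: "x_left e \<le> i" "i < x_right e" "y_bot e \<le> j" "j < y_top e"
        "x_left f \<le> i" "i < x_right f" "y_bot f \<le> j" "j < y_top f"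
    then obtain f' where f': "f' \<in> blocks G" "f = narrow f'" by auto
    have "e' = f'"
      by (rule tiling_eq[OF t e'(1) f'(1), of i j])
        (use ij e'(3) f'(2) in \<open>auto split: if_splits\<close>)
    then show "e = f" using e'(3) f'(2) by simp
  next
    fix i j assume ij: "i < width F" "j < height F"
    then have "i < width G" "j < height G" using w by auto
    then obtain e where e: "e \<in> blocks G" "x_left e \<le> i" "i < x_right e" "y_bot e \<le> j" "j < y_top e"
      by (rule tiling_cover[OF t])
    have "e \<noteq> b" using e(2) left ij by auto
    then show "\<exists>b \<in> blocks F. x_left b \<le> i \<and> i < x_right b \<and> y_bot b \<le> j \<and> j < y_top b"
      using e ij by (intro bexI[of _ "narrow e"]) auto
  qed
  have pF: "packed_floorplan F"
    unfolding packed_floorplan_iff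
  proof (intro conjI ballI impI)
    show "1 \<le> width F" "1 \<le> height F" using w nb by auto
    show "tiling F" by fact
    have "inj_on narrow (blocks G - {b})" by (rule inj_on_inverseI[of _ "widen F y"]) (rule widen)
    then have "card (blocks F) = card (blocks G) - 1"
      using b(1) packed_finite[OF G] by (simp add: card_image)
    then show "card (blocks F) = height F + width F - 1"
      using G w unfolding packed_floorplan_iff by simp
    fix e f assume "e \<in> blocks F" "f \<in> blocks F" and h: "x_right e \<le> x_left f" "y_top f \<le> y_bot e"
    then obtain e' f' where e': "e' \<in> blocks G" "e = narrow e'"
      and f': "f' \<in> blocks G" "f' \<noteq> b" "f = narrow f'" by auto
    have "x_right e' \<le> x_left f'" using h(1) e'(2) f'(3) left_of[OF f'(1,2)] by (auto split: if_splits)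
    then show False
      using packed_no_lower_right[OF G e'(1) f'(1)] h(2) e'(2) f'(3) by simp
  qed
  \<comment> \<open>The lower right corner of \<open>c\<close> is the point \<open>(m, y)\<close>,
    so its bottom side is an edge at height \<open>y\<close> that meets the right border of
    \<open>F\<close>.\<close>
  have "y \<in> right_sites F" if "y \<noteq> 0"
  proof -
    have "c \<noteq> b" using c(2) nb by auto
    then have "narrow c \<in> blocks F" using c(1) by simp
    then have "h_edge F y (width F - 1)"
      unfolding h_edge_def using c(2,3) nc left by (intro bexI[of _ "narrow c"]) auto
    then show ?thesis using right_sites_iff[OF tF] w that nb y_def by simp
  qed
  then have "y \<in> insert 0 (right_sites F)" by auto
  then show thesis by (rule that[OF pF _ GF])
qed

lemma packed_cases:
  assumes G: "packed_floorplan G"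
  obtains "G = unit_floorplan"
  | F y where "packed_floorplan F" "y \<in> insert 0 (right_sites F)" "G = add_right F y"
  | F x where "packed_floorplan F" "x \<in> insert 0 (top_sites F)" "G = add_top F x"
proof -
  note t = packed_tiling[OF G]
  have pos: "1 \<le> width G" "1 \<le> height G" and card: "card (blocks G) = height G + width G - 1"
    using G unfolding packed_floorplan_iff by blast+
  have "width G - 1 < width G" "height G - 1 < height G" using pos by auto
  then obtain b where b: "b \<in> blocks G" "x_left b \<le> width G - 1" "width G - 1 < x_right b"
      "y_bot b \<le> height G - 1" "height G - 1 < y_top b"
    by (rule tiling_cover[OF t])
  have corner: "x_right b = width G" "y_top b = height G"
    using tiling_block[OF t b(1)] b by auto
  show thesis
  proof (cases "x_left b = 0 \<and> y_bot b = 0")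
    case True
    have "e = b" if e: "e \<in> blocks G" for e
      using tiling_eq[OF t e b(1), of "x_left e" "y_bot e"] tiling_block[OF t e] corner True by simp
    then have single: "blocks G = {b}" using b(1) by blast
    \<comment> \<open>With one block, the count gives
      \<open>height G + width G - 1 = 1\<close>.\<close>
    then have one: "width G = 1" "height G = 1" using card pos by auto
    have "b = \<lparr>x_left = 0, x_right = 1, y_bot = 0, y_top = 1\<rparr>"
      using True corner one by (intro block_eqI) simp_all
    then have "G = unit_floorplan"
      using one single by (intro floorplan_eqI) (simp_all add: unit_floorplan_def)
    then show thesis by (rule that(1))
  next
    case False
    then consider "v_rooted G b" | "h_rooted G b" using tiling_rooted[OF t b(1)] by blast
    then show thesis
    proof cases
      case 1
      then show thesis using right_parent[OF G b(1) _ corner] that(2) by blast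
    next
      case 2
      have fb: "flip_block b \<in> blocks (flip G)" using b(1) by simp
      have v: "v_rooted (flip G) (flip_block b)" using 2 unfolding v_rooted_def h_rooted_def by auto
      have fc: "x_right (flip_block b) = width (flip G)" "y_top (flip_block b) = height (flip G)"
        using corner by simp_all
      obtain F x where F: "packed_floorplan F" "x \<in> insert 0 (right_sites F)" "flip G = add_right F x"
        by (rule right_parent[OF packed_flip[OF G] fb v fc])
      have "G = add_top (flip F) x" using F(3) by (metis flip_add_right flip_simps(4))
      moreover have "x \<in> insert 0 (top_sites (flip F))" using F(2) by simp
      ultimately show thesis using that(3) packed_flip[OF F(1)] by blast
    qed
  qed
qed

section \<open>Schroeder floorplans\<close>

text \<open>The pair \<open>w\<close>, \<open>a\<close> of a forbidden configuration in the case
  where \<open>w\<close> reaches the right border; \<open>xa < width F\<close> holds because the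
  vertical segment is internal.\<close>

definition hangs_below :: "floorplan \<Rightarrow> nat \<Rightarrow> bool" where
  "hangs_below F y \<longleftrightarrow>
     (\<exists>a xa a1. internal_hseg F y a (width F) \<and> internal_vseg F xa a1 y \<and> a < xa)"

text \<open>A new left side ending at \<open>y > 0\<close> creates a forbidden configuration exactly if it crosses
  a segment with something hanging below it.\<close>

definition active_sites :: "floorplan \<Rightarrow> nat set" where
  "active_sites F = {y \<in> right_sites F. \<forall>z \<in> right_sites F. y < z \<longrightarrow> \<not> hangs_below F z}"

lemma internal_hseg_bounds: "internal_hseg F y a c \<Longrightarrow> 0 < y \<and> y < height F"
  by (simp add: internal_hseg_def)

lemma internal_vseg_bounds: "internal_vseg F x a c \<Longrightarrow> 0 < x \<and> x < width F"
  by (simp add: internal_vseg_def)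

lemma forbidden_configurationI:
  assumes "internal_hseg F yw w1 xs" "internal_vseg F xa a1 yw"
    "internal_vseg F xs s1 s2" "internal_hseg F s1 t1 t2"
    "w1 < xa" "xa < xs" "s1 < yw" "yw < s2" "t1 < xs" "xs < t2"
  shows "forbidden_configuration F"
  unfolding forbidden_configuration_def using assms by blast

lemma forbidden_configurationE:
  assumes "forbidden_configuration F"
  obtains yw w1 xs xa a1 s1 s2 t1 t2
  where "internal_hseg F yw w1 xs" "internal_vseg F xa a1 yw"
    "internal_vseg F xs s1 s2" "internal_hseg F s1 t1 t2"
    "w1 < xa" "xa < xs" "s1 < yw" "yw < s2" "t1 < xs" "xs < t2"
  using assms unfolding forbidden_configuration_def by blast

context right_addition
begin

lemma right_sites_add_right: "right_sites (add_right F y) = {z \<in> right_sites F. z \<le> y}"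
  unfolding right_sites_def by (auto simp: internal_hseg_add_right)

lemma top_sites_add_right: "top_sites (add_right F y) = insert (width F) (top_sites F)"
  unfolding top_sites_def by (auto simp: internal_vseg_add_right)

lemma hangs_below_add_right:
  assumes z: "z \<le> y"
  shows "hangs_below (add_right F y) z \<longleftrightarrow> hangs_below F z"
proof -
  have "z \<noteq> height F" using z y_less by simp
  then show ?thesis
    unfolding hangs_below_def using z
    by (simp add: internal_hseg_add_right internal_vseg_add_right)
qed

text \<open>Old vertical segments stay as they are and a horizontal one changes at most its end on
  the right border, where no internal \<open>s\<close> lies; hence old configurations survive. A new
  one must use the new left side as \<open>s\<close>. Then \<open>w\<close> is a site above
  \<open>y\<close>, and \<open>t\<close> lies at height \<open>y\<close>, which is internal only for
  nonzero \<open>y\<close>.\<close>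

lemma forbidden_add_right:
  "forbidden_configuration (add_right F y) \<longleftrightarrow>
     forbidden_configuration F \<or> y \<noteq> 0 \<and> (\<exists>z \<in> right_sites F. y < z \<and> hangs_below F z)"
proof
  assume "forbidden_configuration (add_right F y)"
  then obtain yw w1 xs xa a1 s1 s2 t1 t2 where
      w: "internal_hseg (add_right F y) yw w1 xs" and a: "internal_vseg (add_right F y) xa a1 yw"
      and s: "internal_vseg (add_right F y) xs s1 s2" and t: "internal_hseg (add_right F y) s1 t1 t2"
      and ineq: "w1 < xa" "xa < xs" "s1 < yw" "yw < s2" "t1 < xs" "xs < t2"
    by (rule forbidden_configurationE)
  have xs: "xs \<le> width F" using internal_vseg_bounds[OF s] by simp
  \<comment> \<open>Since \<open>a\<close> lies strictly to the left of \<open>s\<close>, it cannot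
    be the new left side.\<close>
  have a': "internal_vseg F xa a1 yw" using a ineq xs unfolding internal_vseg_add_right by auto
  show "forbidden_configuration F \<or> y \<noteq> 0 \<and> (\<exists>z \<in> right_sites F. y < z \<and> hangs_below F z)"
  proof (cases "internal_vseg F xs s1 s2")
    case True
    then have lt: "xs < width F" using internal_vseg_bounds by blast
    then have "internal_hseg F yw w1 xs" using w unfolding internal_hseg_add_right
      by (auto split: if_splits)
    moreover obtain t2' where "internal_hseg F s1 t1 t2'" "xs < t2'"
      using t lt ineq unfolding internal_hseg_add_right by blast
    ultimately show ?thesis using forbidden_configurationI[of F yw w1 xs] a' True ineq by blast
  next
    case False
    then have new: "xs = width F" "s1 = y" using s unfolding internal_vseg_add_right by auto
    then have "internal_hseg F yw w1 (width F)"
      using w unfolding internal_hseg_add_right by auto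
    then have "yw \<in> right_sites F" "hangs_below F yw"
      unfolding right_sites_def hangs_below_def using a' ineq by blast+
    moreover have "y \<noteq> 0" using internal_hseg_bounds[OF t] new by simp
    ultimately show ?thesis using ineq new by blast
  qed
next
  assume "forbidden_configuration F \<or> y \<noteq> 0 \<and> (\<exists>z \<in> right_sites F. y < z \<and> hangs_below F z)"
  then show "forbidden_configuration (add_right F y)"
  proof
    assume "forbidden_configuration F"
    then obtain yw w1 xs xa a1 s1 s2 t1 t2 where
        w: "internal_hseg F yw w1 xs" and a: "internal_vseg F xa a1 yw"
        and s: "internal_vseg F xs s1 s2" and t: "internal_hseg F s1 t1 t2"
        and ineq: "w1 < xa" "xa < xs" "s1 < yw" "yw < s2" "t1 < xs" "xs < t2"
      by (rule forbidden_configurationE)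
    have "xs < width F" using internal_vseg_bounds[OF s] by simp
    then have w': "internal_hseg (add_right F y) yw w1 xs"
      using w unfolding internal_hseg_add_right by blast
    have a': "internal_vseg (add_right F y) xa a1 yw" and s': "internal_vseg (add_right F y) xs s1 s2"
      using a s unfolding internal_vseg_add_right by blast+
    \<comment> \<open>Only the right end of \<open>t\<close> can have moved, and it still lies to
      the right of \<open>xs\<close>.\<close>
    obtain t2' where "internal_hseg (add_right F y) s1 t1 t2'" "xs < t2'"
    proof (cases "t2 < width F")
      case True
      then show thesis using that[of t2] t ineq unfolding internal_hseg_add_right by blast
    next
      case False
      then have "t2 = width F" using tiling_internal_hseg_le[OF tiling t] by simp
      then show thesis
        using that[of "if s1 \<le> y then Suc (width F) else width F"] t \<open>xs < width F\<close>
        unfolding internal_hseg_add_right by auto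
    qed
    then show ?thesis using forbidden_configurationI[OF w' a' s'] ineq by blast
  next
    assume h: "y \<noteq> 0 \<and> (\<exists>z \<in> right_sites F. y < z \<and> hangs_below F z)"
    then obtain z where z: "y < z" "hangs_below F z" by blast
    then obtain a xa a1 where w: "internal_hseg F z a (width F)" and v: "internal_vseg F xa a1 z"
        and ax: "a < xa"
      unfolding hangs_below_def by blast
    obtain t1 where t: "internal_hseg F y t1 (width F)"
      using h site unfolding right_sites_def by blast
    then have "t1 < width F" unfolding internal_hseg_def maximal_run_iff by blast
    moreover have "xa < width F" "z < height F"
      using internal_vseg_bounds[OF v] internal_hseg_bounds[OF w] by simp_all
    moreover have "internal_hseg (add_right F y) z a (width F)"
      "internal_hseg (add_right F y) y t1 (Suc (width F))"
      using w t z unfolding internal_hseg_add_right by auto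
    moreover have "internal_vseg (add_right F y) xa a1 z"
      "internal_vseg (add_right F y) (width F) y (height F)"
      using v unfolding internal_vseg_add_right by auto
    ultimately show ?thesis
      using forbidden_configurationI[of "add_right F y" z a "width F" xa a1 y "height F" t1 "Suc (width F)"]
        ax z by simp
  qed
qed

text \<open>Sites above \<open>y\<close> leave the border, but this activates no lower one: either
  nothing hung below any of them, or \<open>y = 0\<close> and no internal site remains.\<close>

lemma active_sites_add_right:
  assumes "y \<in> insert 0 (active_sites F)"
  shows "active_sites (add_right F y) = {z \<in> active_sites F. z \<le> y}"
proof (cases "y = 0")
  case True
  have "0 \<notin> right_sites F" unfolding right_sites_def internal_hseg_def by simp
  then show ?thesis using True unfolding active_sites_def right_sites_add_right by auto
next
  case False
  then have y: "\<forall>z \<in> right_sites F. y < z \<longrightarrow> \<not> hangs_below F z"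
    using assms unfolding active_sites_def by auto
  show ?thesis
    unfolding active_sites_def right_sites_add_right
    using y hangs_below_add_right by (auto simp: not_le)
qed

end

section \<open>Additions on top and forbidden configurations\<close>

locale top_addition =
  fixes F :: floorplan and x :: nat
  assumes tiling: "tiling F" and width: "0 < width F" and height: "0 < height F"
    and site: "x \<in> insert 0 (top_sites F)"

sublocale top_addition \<subseteq> flipped: right_addition "flip F" x
  using tiling width height site tiling_flip by unfold_locales auto

context top_addition
begin

lemma internal_hseg_add_top:
  "internal_hseg (add_top F x) z a c \<longleftrightarrow>
     internal_hseg F z a c \<or> z = height F \<and> a = x \<and> c = width F"
  using flipped.internal_vseg_add_right[of z a c] by (simp add: add_top_eq_flip)

lemma internal_vseg_add_top:
  "internal_vseg (add_top F x) z a c \<longleftrightarrow>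
     c < height F \<and> internal_vseg F z a c \<or>
     internal_vseg F z a (height F) \<and> c = (if z \<le> x then Suc (height F) else height F)"
  using flipped.internal_hseg_add_right[of z a c] by (simp add: add_top_eq_flip)

lemma top_sites_add_top: "top_sites (add_top F x) = {z \<in> top_sites F. z \<le> x}"
  using flipped.right_sites_add_right by (simp add: add_top_eq_flip)

lemma right_sites_add_top: "right_sites (add_top F x) = insert (height F) (right_sites F)"
  using flipped.top_sites_add_right by (simp add: add_top_eq_flip)

lemma hangs_below_add_top:
  assumes "y < height F"
  shows "hangs_below (add_top F x) y \<longleftrightarrow> hangs_below F y"
  using assms unfolding hangs_below_def
  by (simp add: internal_hseg_add_top internal_vseg_add_top)

text \<open>The new bottom side runs from \<open>x\<close> to the right border. A top site to the
  right of \<open>x\<close> stops on it from below, while one up to \<open>x\<close> continues to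
  the new top border.\<close>

lemma hangs_below_add_top_new:
  "hangs_below (add_top F x) (height F) \<longleftrightarrow> (\<exists>z \<in> top_sites F. x < z)"
  unfolding hangs_below_def top_sites_def
  using internal_hseg_bounds[of F "height F"]
  by (auto simp: internal_hseg_add_top internal_vseg_add_top not_le split: if_splits)

text \<open>The new bottom side reaches the right border, so it cannot be \<open>w\<close>, and it
  lies too high to be \<open>t\<close>. Vertical segments change only in upper ends on the top
  border: \<open>a\<close> ends below that border, and of \<open>s\<close> it matters only that it
  rises above \<open>w\<close>, which holds before and after.\<close>

lemma forbidden_add_top: "forbidden_configuration (add_top F x) \<longleftrightarrow> forbidden_configuration F"
proof
  assume "forbidden_configuration (add_top F x)"
  then obtain yw w1 xs xa a1 s1 s2 t1 t2 where
      w: "internal_hseg (add_top F x) yw w1 xs" and a: "internal_vseg (add_top F x) xa a1 yw"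
      and s: "internal_vseg (add_top F x) xs s1 s2" and t: "internal_hseg (add_top F x) s1 t1 t2"
      and ineq: "w1 < xa" "xa < xs" "s1 < yw" "yw < s2" "t1 < xs" "xs < t2"
    by (rule forbidden_configurationE)
  have "xs < width F" using internal_vseg_bounds[OF s] by simp
  then have w': "internal_hseg F yw w1 xs" using w unfolding internal_hseg_add_top by auto
  have yw: "yw < height F" using internal_hseg_bounds[OF w'] by simp
  have a': "internal_vseg F xa a1 yw"
    using a yw unfolding internal_vseg_add_top by (auto split: if_splits)
  have t': "internal_hseg F s1 t1 t2" using t yw ineq unfolding internal_hseg_add_top by auto
  obtain s2' where "internal_vseg F xs s1 s2'" "yw < s2'"
    using s yw ineq unfolding internal_vseg_add_top by blast
  then show "forbidden_configuration F"
    using forbidden_configurationI[OF w' a' _ t'] ineq by blast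
next
  assume "forbidden_configuration F"
  then obtain yw w1 xs xa a1 s1 s2 t1 t2 where
      w: "internal_hseg F yw w1 xs" and a: "internal_vseg F xa a1 yw"
      and s: "internal_vseg F xs s1 s2" and t: "internal_hseg F s1 t1 t2"
      and ineq: "w1 < xa" "xa < xs" "s1 < yw" "yw < s2" "t1 < xs" "xs < t2"
    by (rule forbidden_configurationE)
  have yw: "yw < height F" using internal_hseg_bounds[OF w] by simp
  have w': "internal_hseg (add_top F x) yw w1 xs" and t': "internal_hseg (add_top F x) s1 t1 t2"
    using w t unfolding internal_hseg_add_top by blast+
  have a': "internal_vseg (add_top F x) xa a1 yw" using a yw unfolding internal_vseg_add_top by blast
  obtain s2' where "internal_vseg (add_top F x) xs s1 s2'" "yw < s2'"
  proof (cases "s2 < height F")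
    case True
    then show thesis using that[of s2] s ineq unfolding internal_vseg_add_top by blast
  next
    case False
    then have "s2 = height F" using tiling_internal_vseg_le[OF tiling s] by simp
    then show thesis
      using that[of "if xs \<le> x then Suc (height F) else height F"] s yw
      unfolding internal_vseg_add_top by auto
  qed
  then show "forbidden_configuration (add_top F x)"
    using forbidden_configurationI[OF w' a' _ t'] ineq by blast
qed

text \<open>The new segment is the topmost site, so nothing can block it; whatever hangs below it
  blocks all other internal sites.\<close>

lemma active_sites_add_top:
  "active_sites (add_top F x) =
     insert (height F) (if \<exists>z \<in> top_sites F. x < z then {} else active_sites F)"
proof -
  have lt: "z < height F" if "z \<in> right_sites F" for z
    using that unfolding right_sites_def internal_hseg_def by blast
  have old: "hangs_below (add_top F x) z \<longleftrightarrow> hangs_below F z" if "z \<in> right_sites F" for z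
    using hangs_below_add_top[OF lt[OF that]] .
  have "height F \<in> active_sites (add_top F x)"
    unfolding active_sites_def right_sites_add_top using lt by fastforce
  moreover have "z \<in> active_sites (add_top F x) \<longleftrightarrow>
      z \<in> active_sites F \<and> \<not> (\<exists>z \<in> top_sites F. x < z)" if "z \<noteq> height F" for z
    unfolding active_sites_def right_sites_add_top
    using that lt old hangs_below_add_top_new by auto
  ultimately have "z \<in> active_sites (add_top F x) \<longleftrightarrow>
      z \<in> insert (height F) (if \<exists>z \<in> top_sites F. x < z then {} else active_sites F)" for z
    by (cases "z = height F") auto
  then show ?thesis by blast
qed

end

section \<open>The generating tree\<close>

lemma packed_right_addition:
  assumes "packed_floorplan F" "y \<in> insert 0 (right_sites F)"
  shows "right_addition F y"
  using assms unfolding packed_floorplan_iff by unfold_locales auto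

lemma packed_top_addition:
  assumes "packed_floorplan F" "x \<in> insert 0 (top_sites F)"
  shows "top_addition F x"
  using assms unfolding packed_floorplan_iff by unfold_locales auto

lemma packed_add_top:
  assumes "packed_floorplan F" "x \<in> insert 0 (top_sites F)"
  shows "packed_floorplan (add_top F x)"
proof -
  interpret top_addition F x by (rule packed_top_addition[OF assms])
  show ?thesis
    using packed_flip[OF flipped.packed_add_right[OF packed_flip[OF assms(1)]]]
    by (simp add: add_top_eq_flip)
qed

lemma add_top_inject:
  assumes "top_addition F x" "top_addition F' x'" and eq: "add_top F x = add_top F' x'"
  shows "F = F' \<and> x = x'"
proof -
  interpret A: top_addition F x by fact
  interpret B: top_addition F' x' by fact
  have "add_right (flip F) x = add_right (flip F') x'" using eq by (metis flip_add_top)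
  then have "flip F = flip F' \<and> x = x'"
    by (rule add_right_inject[OF A.flipped.right_addition_axioms B.flipped.right_addition_axioms])
  then show ?thesis by (metis flip_simps(4))
qed

lemma pfp_children_iff:
  "G \<in> pfp_children F \<longleftrightarrow>
     (\<exists>y \<in> insert 0 (right_sites F). G = add_right F y) \<or>
     (\<exists>x \<in> insert 0 (top_sites F). G = add_top F x)"
  unfolding pfp_children_def right_sites_def top_sites_def by blast

section \<open>Ranks of sites and labels of children\<close>

lemma finite_right_sites: "finite (right_sites F)"
  by (rule finite_subset[of _ "{..<height F}"]) (auto simp: right_sites_def internal_hseg_def)

lemma finite_top_sites: "finite (top_sites F)"
  by (rule finite_subset[of _ "{..<width F}"]) (auto simp: top_sites_def internal_vseg_def)

lemma active_sites_subset: "active_sites F \<subseteq> right_sites F"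
  unfolding active_sites_def by blast

lemma finite_active_sites: "finite (active_sites F)"
  using finite_subset[OF active_sites_subset finite_right_sites] .

lemma zero_not_site: "0 \<notin> top_sites F" "0 \<notin> active_sites F"
  unfolding top_sites_def active_sites_def right_sites_def internal_hseg_def internal_vseg_def
  by simp_all

text \<open>The leading 0 stands for the border, so that index \<open>i\<close> selects the stopping
  point with exactly \<open>i\<close> internal sites up to and including it.\<close>

definition site_list :: "nat set \<Rightarrow> nat list" where
  "site_list S = 0 # sorted_list_of_set S"

lemma set_site_list: "finite S \<Longrightarrow> set (site_list S) = insert 0 S"
  by (simp add: site_list_def)

lemma length_site_list: "length (site_list S) = Suc (card S)"
  by (simp add: site_list_def)

lemma distinct_site_list: "finite S \<Longrightarrow> 0 \<notin> S \<Longrightarrow> distinct (site_list S)"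
  by (simp add: site_list_def)

lemma card_le_site_list:
  assumes S: "finite S" "0 \<notin> S" and i: "i \<le> card S"
  shows "card {s \<in> S. s \<le> site_list S ! i} = i"
proof (cases i)
  case 0
  have "{s \<in> S. s \<le> 0} = {}" using S(2) by auto
  then show ?thesis using 0 by (simp add: site_list_def)
next
  case (Suc j)
  let ?l = "sorted_list_of_set S"
  have l: "sorted_wrt (<) ?l" "length ?l = card S" by simp_all
  have j: "j < card S" using i Suc by simp
  \<comment> \<open>Strict monotonicity of the sorted list: the elements up to entry
    \<open>j\<close> are those at positions \<open>0, ..., j\<close>, which are \<open>j + 1\<close>
    many.\<close>
  have "{s \<in> S. s \<le> ?l ! j} = (!) ?l ` {..j}"
  proof (intro set_eqI iffI)
    fix s assume s: "s \<in> {s \<in> S. s \<le> ?l ! j}"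
    then have "s \<in> set ?l" using S(1) by simp
    then obtain k where k: "k < card S" "s = ?l ! k" using l(2) by (metis in_set_conv_nth)
    have "\<not> j < k" using sorted_wrt_nth_less[OF l(1), of j k] s k l(2) by auto
    then show "s \<in> (!) ?l ` {..j}" using k by auto
  next
    fix s assume "s \<in> (!) ?l ` {..j}"
    then obtain k where k: "k \<le> j" "s = ?l ! k" by auto
    have "?l ! k \<in> set ?l" using k j l(2) by (intro nth_mem) simp
    moreover have "?l ! k \<le> ?l ! j"
      using sorted_wrt_nth_less[OF l(1), of k j] k j l(2) by (cases "k = j") auto
    ultimately show "s \<in> {s \<in> S. s \<le> ?l ! j}" using S(1) k by simp
  qed
  moreover have "inj_on ((!) ?l) {..j}"
    using j l(2) by (intro inj_on_nth) auto
  ultimately have "card {s \<in> S. s \<le> ?l ! j} = Suc j" by (simp add: card_image)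
  then show ?thesis using Suc by (simp add: site_list_def)
qed

text \<open>Separates the last stopping point, beyond which no site lies, from the others; for top
  additions this is the split between \<open>(h + 1, k)\<close> and the labels
  \<open>(2, j)\<close>.\<close>

lemma ex_greater_site_list:
  assumes S: "finite S" "0 \<notin> S" and i: "i \<le> card S"
  shows "(\<exists>s \<in> S. site_list S ! i < s) \<longleftrightarrow> i < card S"
proof
  assume "\<exists>s \<in> S. site_list S ! i < s"
  then obtain s where "s \<in> S" "site_list S ! i < s" by blast
  then have "s \<in> S - {s \<in> S. s \<le> site_list S ! i}" by simp
  then have "{s \<in> S. s \<le> site_list S ! i} \<subset> S" by blast
  then have "card {s \<in> S. s \<le> site_list S ! i} < card S" by (rule psubset_card_mono[OF S(1)])
  then show "i < card S" using card_le_site_list[OF assms] by simp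
next
  assume lt: "i < card S"
  show "\<exists>s \<in> S. site_list S ! i < s"
  proof (rule ccontr)
    assume "\<not> (\<exists>s \<in> S. site_list S ! i < s)"
    then have "{s \<in> S. s \<le> site_list S ! i} = S" by (auto simp: not_less)
    then show False using card_le_site_list[OF assms] lt by simp
  qed
qed

definition sch_label :: "floorplan \<Rightarrow> nat \<times> nat" where
  "sch_label F = (Suc (card (active_sites F)), Suc (card (top_sites F)))"

text \<open>Positions in this list become addresses, so its order has to reproduce that of
  \<open>new_sch\<close>: right additions before top ones, each by increasing stopping
  point.\<close>

definition sch_children :: "floorplan \<Rightarrow> floorplan list" where
  "sch_children F =
     map (add_right F) (site_list (active_sites F)) @ map (add_top F) (site_list (top_sites F))"

lemma sch_label_add_right:
  assumes F: "packed_floorplan F" and y: "y \<in> insert 0 (active_sites F)"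
  shows "sch_label (add_right F y) =
    (Suc (card {z \<in> active_sites F. z \<le> y}), Suc (Suc (card (top_sites F))))"
proof -
  have "y \<in> insert 0 (right_sites F)" using y active_sites_subset by blast
  then interpret right_addition F y by (rule packed_right_addition[OF F])
  have "width F \<notin> top_sites F" by (simp add: top_sites_def internal_vseg_def)
  then show ?thesis
    unfolding sch_label_def active_sites_add_right[OF y] top_sites_add_right
    using finite_top_sites by simp
qed

lemma sch_label_add_top:
  assumes F: "packed_floorplan F" and x: "x \<in> insert 0 (top_sites F)"
  shows "sch_label (add_top F x) =
    (if \<exists>z \<in> top_sites F. x < z then 2 else Suc (Suc (card (active_sites F))),
     Suc (card {z \<in> top_sites F. z \<le> x}))"
proof -
  interpret top_addition F x by (rule packed_top_addition[OF F x])
  have "height F \<notin> active_sites F"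
    by (simp add: active_sites_def right_sites_def internal_hseg_def)
  then show ?thesis
    unfolding sch_label_def active_sites_add_top top_sites_add_top
    using finite_active_sites by simp
qed

lemma map_sch_label_children:
  assumes F: "packed_floorplan F"
  shows "map sch_label (sch_children F) = new_sch (sch_label F)"
proof -
  let ?A = "active_sites F" and ?T = "top_sites F"
  have "map (\<lambda>y. sch_label (add_right F y)) (site_list ?A) =
      map (\<lambda>i. (i, Suc (card ?T) + 1)) [1..<Suc (card ?A) + 1]"
  proof (rule nth_equalityI)
    fix i assume "i < length (map (\<lambda>y. sch_label (add_right F y)) (site_list ?A))"
    then have i: "i < length (site_list ?A)" by simp
    have "site_list ?A ! i \<in> insert 0 ?A"
      using nth_mem[OF i] set_site_list[OF finite_active_sites] by simp
    from sch_label_add_right[OF F this]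
    show "map (\<lambda>y. sch_label (add_right F y)) (site_list ?A) ! i =
        map (\<lambda>i. (i, Suc (card ?T) + 1)) [1..<Suc (card ?A) + 1] ! i"
      using i card_le_site_list[OF finite_active_sites zero_not_site(2), of i]
      by (simp add: length_site_list nth_append del: upt_Suc)
  qed (simp add: length_site_list)
  moreover have "map (\<lambda>x. sch_label (add_top F x)) (site_list ?T) =
      map (\<lambda>j. (2, j)) [1..<Suc (card ?T)] @ [(Suc (card ?A) + 1, Suc (card ?T))]"
  proof (rule nth_equalityI)
    fix i assume "i < length (map (\<lambda>x. sch_label (add_top F x)) (site_list ?T))"
    then have i: "i < length (site_list ?T)" by simp
    have "site_list ?T ! i \<in> insert 0 ?T"
      using nth_mem[OF i] set_site_list[OF finite_top_sites] by simp
    note label = sch_label_add_top[OF F this]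
    have le: "i \<le> card ?T" using i by (simp add: length_site_list)
    note label = label[unfolded card_le_site_list[OF finite_top_sites zero_not_site(1) le]
        ex_greater_site_list[OF finite_top_sites zero_not_site(1) le]]
    show "map (\<lambda>x. sch_label (add_top F x)) (site_list ?T) ! i =
        (map (\<lambda>j. (2, j)) [1..<Suc (card ?T)] @ [(Suc (card ?A) + 1, Suc (card ?T))]) ! i"
    proof (cases "i < card ?T")
      case True
      have "[1..<Suc (card ?T)] ! i = Suc i" using True by (subst nth_upt) simp_all
      then show ?thesis using True label i by (simp add: nth_append del: upt_Suc)
    next
      case False
      \<comment> \<open>No top site lies beyond the last stopping point, so all active sites survive
        and the new segment adds one: the child \<open>(h + 1, k)\<close>.\<close>
      then have "i = card ?T" using le by simp
      then show ?thesis using label i by (simp add: nth_append del: upt_Suc)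
    qed
  qed (simp add: length_site_list)
  ultimately show ?thesis
    by (simp add: sch_children_def sch_label_def o_def del: upt_Suc)
qed

text \<open>Over a floorplan without forbidden configuration, \<open>forbidden_add_right\<close>
  reduces to activity of the stopping point or its being 0, and \<open>forbidden_add_top\<close>
  excludes no child.\<close>

lemma set_sch_children:
  assumes F: "schroeder_pfp F"
  shows "set (sch_children F) = {G. schroeder_pfp G \<and> G \<in> pfp_children F}"
proof -
  have p: "packed_floorplan F" and nf: "\<not> forbidden_configuration F"
    using F by (simp_all add: schroeder_pfp_def)
  have right: "schroeder_pfp (add_right F y) \<longleftrightarrow> y \<in> insert 0 (active_sites F)"
    if y: "y \<in> insert 0 (right_sites F)" for y
  proof -
    interpret right_addition F y by (rule packed_right_addition[OF p y])
    show ?thesis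
      using packed_add_right[OF p] nf y
      unfolding schroeder_pfp_def active_sites_def forbidden_add_right by auto
  qed
  have top: "schroeder_pfp (add_top F x)" if x: "x \<in> insert 0 (top_sites F)" for x
  proof -
    interpret top_addition F x by (rule packed_top_addition[OF p x])
    show ?thesis
      using packed_add_top[OF p x] nf unfolding schroeder_pfp_def forbidden_add_top by simp
  qed
  have "set (sch_children F) =
      add_right F ` insert 0 (active_sites F) \<union> add_top F ` insert 0 (top_sites F)"
    unfolding sch_children_def
    by (simp only: set_append set_map set_site_list[OF finite_active_sites]
        set_site_list[OF finite_top_sites])
  also have "\<dots> = {G. schroeder_pfp G \<and> G \<in> pfp_children F}"
  proof (intro set_eqI iffI)
    fix G assume "G \<in> add_right F ` insert 0 (active_sites F) \<union> add_top F ` insert 0 (top_sites F)"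
    then consider y where "y \<in> insert 0 (active_sites F)" "G = add_right F y"
      | x where "x \<in> insert 0 (top_sites F)" "G = add_top F x" by blast
    then show "G \<in> {G. schroeder_pfp G \<and> G \<in> pfp_children F}"
    proof cases
      case 1
      then have "y \<in> insert 0 (right_sites F)" using active_sites_subset by blast
      then show ?thesis using right[of y] 1 unfolding pfp_children_iff by blast
    next
      case 2
      then show ?thesis using top[of x] unfolding pfp_children_iff by blast
    qed
  next
    fix G assume "G \<in> {G. schroeder_pfp G \<and> G \<in> pfp_children F}"
    then consider y where "y \<in> insert 0 (right_sites F)" "G = add_right F y" "schroeder_pfp G"
      | x where "x \<in> insert 0 (top_sites F)" "G = add_top F x"
      unfolding pfp_children_iff by blast
    then show "G \<in> add_right F ` insert 0 (active_sites F) \<union> add_top F ` insert 0 (top_sites F)"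
    proof cases
      case 1
      then show ?thesis using right[of y] by blast
    next
      case 2
      then show ?thesis by blast
    qed
  qed
  finally show ?thesis .
qed

text \<open>Within each half an addition determines its stopping point; across the halves, no
  floorplan arises from both kinds of addition.\<close>

lemma distinct_sch_children:
  assumes F: "packed_floorplan F"
  shows "distinct (sch_children F)"
proof -
  have ra: "right_addition F y" if "y \<in> insert 0 (active_sites F)" for y
    using packed_right_addition[OF F, of y] that active_sites_subset by blast
  have ta: "top_addition F x" if "x \<in> insert 0 (top_sites F)" for x
    using packed_top_addition[OF F that] .
  have "inj_on (add_right F) (insert 0 (active_sites F))"
    by (rule inj_onI) (use add_right_inject[OF ra ra] in simp)
  moreover have "inj_on (add_top F) (insert 0 (top_sites F))"
    by (rule inj_onI) (use add_top_inject[OF ta ta] in simp)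
  moreover have "add_right F y \<noteq> add_top F x"
    if "y \<in> insert 0 (active_sites F)" "x \<in> insert 0 (top_sites F)" for x y
  proof -
    interpret top_addition F x by (rule ta[OF that(2)])
    show ?thesis by (rule add_right_neq_add_top[OF ra[OF that(1)] flipped.right_addition_axioms])
  qed
  then have "add_right F ` insert 0 (active_sites F) \<inter> add_top F ` insert 0 (top_sites F) = {}"
    by blast
  ultimately show ?thesis
    unfolding sch_children_def
    using distinct_site_list[OF finite_active_sites zero_not_site(2), of F]
      distinct_site_list[OF finite_top_sites zero_not_site(1), of F]
    by (simp only: distinct_append distinct_map set_map set_site_list[OF finite_active_sites]
        set_site_list[OF finite_top_sites] simp_thms)
qed

section \<open>Parents of Schroeder floorplans\<close>

lemma pfp_parent_unique:
  assumes F: "packed_floorplan F" "G \<in> pfp_children F"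
    and F': "packed_floorplan F'" "G \<in> pfp_children F'"
  shows "F = F'"
proof -
  have mixed: "add_right E y \<noteq> add_top E' x"
    if "packed_floorplan E" "y \<in> insert 0 (right_sites E)"
      "packed_floorplan E'" "x \<in> insert 0 (top_sites E')" for E E' x y
  proof -
    interpret top_addition E' x by (rule packed_top_addition[OF that(3,4)])
    show ?thesis
      by (rule add_right_neq_add_top[OF packed_right_addition[OF that(1,2)]
            flipped.right_addition_axioms])
  qed
  from F(2) consider y where "y \<in> insert 0 (right_sites F)" "G = add_right F y"
    | x where "x \<in> insert 0 (top_sites F)" "G = add_top F x"
    unfolding pfp_children_iff by blast
  note left = this
  from F'(2) consider y where "y \<in> insert 0 (right_sites F')" "G = add_right F' y"
    | x where "x \<in> insert 0 (top_sites F')" "G = add_top F' x"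
    unfolding pfp_children_iff by blast
  note right = this
  show ?thesis
  proof (cases rule: left)
    case (1 y)
    note y = 1
    show ?thesis
    proof (cases rule: right)
      case (1 y')
      have "add_right F y = add_right F' y'" by (rule trans[OF sym[OF y(2)] 1(2)])
      from add_right_inject[OF packed_right_addition[OF F(1) y(1)]
          packed_right_addition[OF F'(1) 1(1)] this]
      show ?thesis ..
    next
      case (2 x')
      show ?thesis by (rule notE[OF mixed[OF F(1) y(1) F'(1) 2(1)] trans[OF sym[OF y(2)] 2(2)]])
    qed
  next
    case (2 x)
    note x = 2
    show ?thesis
    proof (cases rule: right)
      case (1 y')
      show ?thesis by (rule notE[OF mixed[OF F'(1) 1(1) F(1) x(1)] trans[OF sym[OF 1(2)] x(2)]])
    next
      case (2 x')
      have "add_top F x = add_top F' x'" by (rule trans[OF sym[OF x(2)] 2(2)])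
      from add_top_inject[OF packed_top_addition[OF F(1) x(1)]
          packed_top_addition[OF F'(1) 2(1)] this]
      show ?thesis ..
    qed
  qed
qed

text \<open>The class is closed under taking parents because both kinds of addition preserve every
  forbidden configuration.\<close>

lemma schroeder_parent:
  assumes G: "schroeder_pfp G" "G \<noteq> unit_floorplan"
  obtains F where "schroeder_pfp F" "G \<in> pfp_children F"
proof -
  have p: "packed_floorplan G" and nf: "\<not> forbidden_configuration G"
    using G by (simp_all add: schroeder_pfp_def)
  from p show thesis
  proof (cases rule: packed_cases)
    case 1
    then show thesis using G(2) by simp
  next
    case (2 F y)
    interpret right_addition F y by (rule packed_right_addition[OF 2(1,2)])
    have "schroeder_pfp F" using 2 nf forbidden_add_right unfolding schroeder_pfp_def by blast
    moreover have "G \<in> pfp_children F" unfolding pfp_children_iff using 2 by blast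
    ultimately show thesis by (rule that)
  next
    case (3 F x)
    interpret top_addition F x by (rule packed_top_addition[OF 3(1,2)])
    have "schroeder_pfp F" using 3 nf forbidden_add_top unfolding schroeder_pfp_def by blast
    moreover have "G \<in> pfp_children F" unfolding pfp_children_iff using 3 by blast
    ultimately show thesis by (rule that)
  qed
qed

lemma pfp_children_size:
  "G \<in> pfp_children F \<Longrightarrow> width G + height G = Suc (width F + height F)"
  unfolding pfp_children_iff by auto

lemma unit_floorplan_simps [simp]:
  "width unit_floorplan = 1" "height unit_floorplan = 1"
  "blocks unit_floorplan = {\<lparr>x_left = 0, x_right = 1, y_bot = 0, y_top = 1\<rparr>}"
  by (simp_all add: unit_floorplan_def)

lemma schroeder_unit: "schroeder_pfp unit_floorplan"
proof -
  have "tiling unit_floorplan" by (rule tilingI) auto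
  then have "packed_floorplan unit_floorplan" unfolding packed_floorplan_iff by simp
  moreover have "\<not> forbidden_configuration unit_floorplan"
    unfolding forbidden_configuration_def internal_hseg_def by simp
  ultimately show ?thesis by (simp add: schroeder_pfp_def)
qed

lemma sch_label_unit: "sch_label unit_floorplan = (1, 1)"
proof -
  have "right_sites unit_floorplan = {}" "top_sites unit_floorplan = {}"
    by (auto simp: right_sites_def top_sites_def internal_hseg_def internal_vseg_def)
  then show ?thesis using active_sites_subset[of unit_floorplan] by (simp add: sch_label_def)
qed

theorem theorem9: "rooted_iso schroeder_pfp_tree T_Sch"
  unfolding schroeder_pfp_tree_def T_Sch_def
proof (rule succession_tree_iso[where lab = sch_label and ch = sch_children
      and size_of = "\<lambda>F. width F + height F"])
  show "unit_floorplan \<in> {F. schroeder_pfp F}" using schroeder_unit by simp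
  show "sch_label unit_floorplan = (1, 1)" by (rule sch_label_unit)
next
  fix F assume "F \<in> {F. schroeder_pfp F}"
  then have F: "schroeder_pfp F" "packed_floorplan F" by (simp_all add: schroeder_pfp_def)
  show "set (sch_children F) =
      {G \<in> {F. schroeder_pfp F}. (F, G) \<in> {(F, G). schroeder_pfp F \<and> schroeder_pfp G \<and> G \<in> pfp_children F}}"
    using set_sch_children[OF F(1)] F(1) by simp
  show "distinct (sch_children F)" by (rule distinct_sch_children[OF F(2)])
  show "map sch_label (sch_children F) = new_sch (sch_label F)"
    by (rule map_sch_label_children[OF F(2)])
next
  fix G assume "G \<in> {F. schroeder_pfp F}" "G \<noteq> unit_floorplan"
  then show "\<exists>F \<in> {F. schroeder_pfp F}.
      (F, G) \<in> {(F, G). schroeder_pfp F \<and> schroeder_pfp G \<and> G \<in> pfp_children F}"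
    using schroeder_parent[of G] by auto
next
  fix F F' G
  assume "(F, G) \<in> {(F, G). schroeder_pfp F \<and> schroeder_pfp G \<and> G \<in> pfp_children F}"
    "(F', G) \<in> {(F, G). schroeder_pfp F \<and> schroeder_pfp G \<and> G \<in> pfp_children F}"
  then show "F = F'" using pfp_parent_unique unfolding schroeder_pfp_def by blast
next
  fix F G
  assume "(F, G) \<in> {(F, G). schroeder_pfp F \<and> schroeder_pfp G \<and> G \<in> pfp_children F}"
  then show "width F + height F < width G + height G" using pfp_children_size[of G F] by simp
next
  fix F
  \<comment> \<open>Width and height of a parent of the root would add up to 1, but both are at
    least 1.\<close>
  show "(F, unit_floorplan) \<notin> {(F, G). schroeder_pfp F \<and> schroeder_pfp G \<and> G \<in> pfp_children F}"
    using pfp_children_size[of unit_floorplan F]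
    by (auto simp: schroeder_pfp_def packed_floorplan_def)
qed

end
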